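(* (1) Suppose that the rows of a nonzero matrix $M\in\mathbb R^{m\times n}$ have Euclidean norm bounded by $b$. Then $\sigma(M)\ge\alpha(M)\,b^{1-n}n^{-1/2}$. If $M=M(\pi)$ is the weight matrix of a rational representation $\pi$ of a symmetric subgroup of $\mathrm{GL}(n)$, then $\gamma(\pi)\ge\alpha(M)\,b^{1-n}n^{-1}$. (2) A rational representation $\pi$ of $\mathrm{GL}(n_1)\times\dots\times\mathrm{GL}(n_k)$ satisfies $\gamma(\pi)\ge N(\pi)^{1-n}n^{-1}$, where $n=n_1+\dots+n_k$. (3) Let $\pi_0$ be the restriction to $\mathrm{SL}(n_1)\times\dots\times\mathrm{SL}(n_k)$ of a rational representation $\pi$ of $\mathrm{GL}(n_1)\times\dots\times\mathrm{GL}(n_k)$, and let $n=n_1+\dots+n_k$ and $R:=\operatorname{lcm}(n_1,\dots,n_k)$. Then $\gamma(\pi_0)\ge R^{-n}N(\pi)^{1-n}n^{-1}$.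
   Context: For a nonzero real matrix $M$: $\alpha(M)$ is the minimum of $|\det(A)|$ over all invertible square submatrices $A$ of $M$, and the gap $\sigma(M)$ is the minimum, over all invertible square submatrices $B$ of $M$ (of any size $r\times r$, $1\le r\le\min\{m,n\}$), of the smallest singular value of $B$. Symmetric subgroup: a connected, Zariski-closed subgroup $G\subseteq\mathrm{GL}(n)$ (over $\mathbb C$) closed under conjugate transpose; $K=G\cap U(n)$. Products such as $\mathrm{GL}(n_1)\times\dots\times\mathrm{GL}(n_k)$ are embedded block-diagonally in $\mathrm{GL}(n)$. Rational representation: a finite-dimensional complex representation whose matrix entries are polynomials in the $g_{i,j}$ and $\det(g)^{-1}$. Weights: let $T_K$ be a maximal connected commutative subgroup of $K$, assumed diagonal, and $T_G=T_K\exp(i\mathrm{Lie}(T_K))$. Then $V=\bigoplus_{\omega\in\Omega(\pi)}V_\omega$ with $V_\omega\ne0$, $\Omega(\pi)\subset i\mathrm{Lie}(T_K)$ and $\pi(e^H)w=e^{\operatorname{tr}[H\omega]}w$ for $w\in V_\omega$, $H\in\mathrm{Lie}(T_G)$. Weights are real diagonal matrices, identified with vectors in $\mathbb R^n$. For products of $\mathrm{GL}(n_i)$'s they are the usual integer weight vectors in $\mathbb Z^n$; for the restriction to $\mathrm{SL}$'s, the weight $(\omega_1,\dots,\omega_k)$, $\omega_i\in\mathbb Z^{n_i}$, becomes $(\tilde\omega_1,\dots,\tilde\omega_k)$ with $\tilde\omega_i=\omega_i-\frac{s_i}{n_i}(1,\dots,1)$, $s_i$ the sum of the entries of $\omega_i$.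 The weight matrix $M(\pi)$ has the distinct elements of $\Omega(\pi)$ as its rows (each once). Weight norm: $N(\pi)=\max_{\omega\in\Omega(\pi)}\|\omega\|_2$. Weight margin: $\gamma(\pi)=\min\{d(0,\operatorname{conv}\Gamma):\emptyset\ne\Gamma\subseteq\Omega(\pi),\ 0\notin\operatorname{conv}\Gamma\}$ (Euclidean distance), $+\infty$ if there is no such $\Gamma$. In (2) and (3), if $N(\pi)=0$ then $\gamma=+\infty$ and the inequality is regarded as trivially true.
   Formalization: In part (1) both inequalities are proved under the added assumption that the row-norm bound b is at least 1; without it they fail, e.g. for M = [1/2, 0] with b = 1/2. *)

theory Defs
  imports
    "HOL-Analysis.Analysis"
    "Jordan_Normal_Form.Char_Poly"
    "Jordan_Normal_Form.DL_Submatrix"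
begin

no_notation vec_index (infixl \<open>$\<close> 100)

text \<open>
  Real \<open>m \<times> n\<close> matrices, whose square submatrices have varying size, are matrices of
  \<^theory>\<open>Jordan_Normal_Form.Matrix\<close>. Complex matrix groups live in \<open>complex^'n^'n\<close>, where
  topology is available; there \<open>n\<close> is \<open>CARD('n)\<close>.
\<close>

section \<open>Submatrices and the gap\<close>

text \<open>The empty submatrix (invertible, of determinant 1) is excluded: the size is at least 1.\<close>

definition invertible_submatrices :: "real Matrix.mat \<Rightarrow> real Matrix.mat set" where
  "invertible_submatrices M =
     {A. (\<exists>I J. I \<subseteq> {..<dim_row M} \<and> J \<subseteq> {..<dim_col M} \<and> card I = card J \<and> I \<noteq> {}
            \<and> A = submatrix M I J)
         \<and> invertible_mat A}"

definition min_subdet :: "real Matrix.mat \<Rightarrow> real" where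
  "min_subdet M = Min ((\<lambda>A. \<bar>Determinant.det A\<bar>) ` invertible_submatrices M)"

definition singular_values :: "real Matrix.mat \<Rightarrow> real set" where
  "singular_values B = {sqrt k | k. eigenvalue (transpose_mat B * B) k}"

definition gap :: "real Matrix.mat \<Rightarrow> real" where
  "gap M = Min ((\<lambda>B. Min (singular_values B)) ` invertible_submatrices M)"

text \<open>The row bound \<open>b\<close> in \<open>gap M \<ge> min_subdet M * b\<^sup>1\<^sup>-\<^sup>n * n\<^sup>-\<^sup>1\<^sup>/\<^sup>2\<close> has to be at least 1, since
  submatrices may be smaller than \<open>n\<close>: for \<open>M = [1/2, 0]\<close> and \<open>b = 1/2\<close> the left-hand side
  is \<open>1/2\<close> and the right-hand side is \<open>1/\<surd>2\<close>.\<close>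

definition l2norm :: "real Matrix.vec \<Rightarrow> real" where
  "l2norm v = sqrt (scalar_prod v v)"

section \<open>Complex matrix groups\<close>

definition GL :: "(complex^'n^'n) monoid" where
  "GL = \<lparr>carrier = {g. invertible g}, mult = (**), one = Finite_Cartesian_Product.mat 1\<rparr>"

definition ctranspose :: "complex^'n^'n \<Rightarrow> complex^'n^'n" where
  "ctranspose A = (\<chi> i j. cnj (A $ j $ i))"

definition unitary_group :: "(complex^'n^'n) set" where
  "unitary_group = {g. ctranspose g ** g = Finite_Cartesian_Product.mat 1}"

definition mexp :: "complex^'n^'n \<Rightarrow> complex^'n^'n" where
  "mexp A = (\<Sum>k. (1 / fact k) *\<^sub>R (((**) A ^^ k) (Finite_Cartesian_Product.mat 1)))"

definition lie_algebra :: "(complex^'n^'n) set \<Rightarrow> (complex^'n^'n) set" where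
  "lie_algebra T = {X. \<forall>t::real. mexp (t *\<^sub>R X) \<in> T}"

text \<open>The algebra of functions generated by a set of functions. Generated by the matrix entries it
  consists of the polynomial functions.\<close>

inductive_set generated_algebra :: "('a \<Rightarrow> complex) set \<Rightarrow> ('a \<Rightarrow> complex) set"
  for S where
    gen: "f \<in> S \<Longrightarrow> f \<in> generated_algebra S"
  | const: "(\<lambda>_. c) \<in> generated_algebra S"
  | add: "f \<in> generated_algebra S \<Longrightarrow> g \<in> generated_algebra S \<Longrightarrow> (\<lambda>x. f x + g x) \<in> generated_algebra S"
  | mult: "f \<in> generated_algebra S \<Longrightarrow> g \<in> generated_algebra S \<Longrightarrow> (\<lambda>x. f x * g x) \<in> generated_algebra S"

definition entry_functions :: "(complex^'n^'n \<Rightarrow> complex) set" where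
  "entry_functions = {(\<lambda>g. g $ i $ j) | i j. True}"

definition zariski_closed :: "(complex^'n^'n) set \<Rightarrow> bool" where
  "zariski_closed G \<longleftrightarrow>
     (\<exists>P \<subseteq> generated_algebra entry_functions. G = {g \<in> carrier GL. \<forall>p\<in>P. p g = 0})"

text \<open>Connectedness refers to the Euclidean topology; for Zariski-closed subgroups this agrees
  with connectedness in the Zariski topology.\<close>

definition symmetric_subgroup :: "(complex^'n^'n) set \<Rightarrow> bool" where
  "symmetric_subgroup G \<longleftrightarrow>
     subgroup G GL \<and> zariski_closed G \<and> connected G \<and> (\<forall>g\<in>G. ctranspose g \<in> G)"

text \<open>A map \<open>b :: 'n \<Rightarrow> 'k\<close> onto \<open>'k\<close> splits the \<open>n\<close> coordinates into \<open>k\<close> blocks of sizes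
  \<open>n\<^sub>i = card (b -` {i})\<close>. The \<open>i\<close>-th component of a block-diagonal matrix is represented by the
  \<open>n \<times> n\<close> matrix with all other diagonal blocks replaced by identity matrices; this changes
  no determinant.\<close>

definition GL_prod :: "('n::finite \<Rightarrow> 'k) \<Rightarrow> (complex^'n^'n) set" where
  "GL_prod b = {g \<in> carrier GL. \<forall>p q. b p \<noteq> b q \<longrightarrow> g $ p $ q = 0}"

definition block_component :: "('n::finite \<Rightarrow> 'k) \<Rightarrow> 'k \<Rightarrow> complex^'n^'n \<Rightarrow> complex^'n^'n" where
  "block_component b i g =
     (\<chi> p q. if b p = i \<and> b q = i then g $ p $ q else if p = q then 1 else 0)"

definition SL_prod :: "('n::finite \<Rightarrow> 'k) \<Rightarrow> (complex^'n^'n) set" where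
  "SL_prod b = {g \<in> GL_prod b. \<forall>i. Determinants.det (block_component b i g) = 1}"

section \<open>Rational representations and weights\<close>

definition rational_representation ::
  "(complex^'n^'n) set \<Rightarrow> (complex^'n^'n \<Rightarrow> complex^'d^'d) \<Rightarrow> bool" where
  "rational_representation G \<pi> \<longleftrightarrow>
     \<pi> \<in> hom (GL\<lparr>carrier := G\<rparr>) GL \<and>
     (\<forall>i j. \<exists>f \<in> generated_algebra (entry_functions \<union> {\<lambda>g. inverse (Determinants.det g)}).
        \<forall>g\<in>G. \<pi> g $ i $ j = f g)"

definition connected_commutative_subgroup ::
  "(complex^'n^'n) set \<Rightarrow> (complex^'n^'n) set \<Rightarrow> bool" where
  "connected_commutative_subgroup K T \<longleftrightarrow>
     subgroup T GL \<and> T \<subseteq> K \<and> connected T \<and> (\<forall>s\<in>T. \<forall>t\<in>T. s ** t = t ** s)"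

text \<open>\<open>T\<close> is a possible choice of \<open>T\<^sub>K\<close> for \<open>K = G \<inter> U(n)\<close>. Maximality is among all connected
  commutative subgroups of \<open>K\<close>, not only the diagonal ones.\<close>

definition diagonal_maximal_torus ::
  "(complex^'n^'n) set \<Rightarrow> (complex^'n^'n) set \<Rightarrow> bool" where
  "diagonal_maximal_torus G T \<longleftrightarrow>
     connected_commutative_subgroup (G \<inter> unitary_group) T \<and>
     (\<forall>T'. connected_commutative_subgroup (G \<inter> unitary_group) T' \<longrightarrow> T \<subseteq> T' \<longrightarrow> T' = T) \<and>
     (\<forall>t\<in>T. \<forall>i j. i \<noteq> j \<longrightarrow> t $ i $ j = 0)"

definition complex_torus :: "(complex^'n^'n) set \<Rightarrow> (complex^'n^'n) set" where
  "complex_torus T = {t ** mexp (map_matrix ((*) \<i>) X) | t X. t \<in> T \<and> X \<in> lie_algebra T}"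

definition real_diag :: "real^'n \<Rightarrow> complex^'n^'n" where
  "real_diag \<omega> = (\<chi> i j. if i = j then complex_of_real (\<omega> $ i) else 0)"

definition weight_space ::
  "(complex^'n^'n) set \<Rightarrow> (complex^'n^'n \<Rightarrow> complex^'d^'d) \<Rightarrow> real^'n \<Rightarrow> (complex^'d) set" where
  "weight_space T \<pi> \<omega> =
     {w. \<forall>H \<in> lie_algebra (complex_torus T).
           \<pi> (mexp H) *v w = exp (Determinants.trace (H ** real_diag \<omega>)) *s w}"

definition weights ::
  "(complex^'n^'n) set \<Rightarrow> (complex^'n^'n \<Rightarrow> complex^'d^'d) \<Rightarrow> (real^'n) set" where
  "weights T \<pi> =
     {\<omega>. real_diag \<omega> \<in> map_matrix ((*) \<i>) ` lie_algebra T \<and> weight_space T \<pi> \<omega> \<noteq> {0}}"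

definition weight_norm :: "(real^'n) set \<Rightarrow> real" where
  "weight_norm \<Omega> = Max (norm ` \<Omega>)"

definition weight_margin :: "(real^'n) set \<Rightarrow> ereal" where
  "weight_margin \<Omega> =
     (INF \<Gamma> \<in> {\<Gamma>. \<Gamma> \<noteq> {} \<and> \<Gamma> \<subseteq> \<Omega> \<and> 0 \<notin> convex hull \<Gamma>}. ereal (infdist 0 (convex hull \<Gamma>)))"

text \<open>Coordinates indexed by \<open>'n\<close> are listed in a fixed order, the one of \<^const>\<open>from_nat_into\<close>.
  The order of the rows of a weight matrix is arbitrary.\<close>

definition coordinate_vec :: "real^'n \<Rightarrow> real Matrix.vec" where
  "coordinate_vec \<omega> = Matrix.vec CARD('n) (\<lambda>j. \<omega> $ from_nat_into (UNIV :: 'n set) j)"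

definition is_weight_matrix :: "(real^'n) set \<Rightarrow> real Matrix.mat \<Rightarrow> bool" where
  "is_weight_matrix \<Omega> M \<longleftrightarrow>
     dim_col M = CARD('n) \<and> distinct (Matrix.rows M) \<and>
     set (Matrix.rows M) = coordinate_vec ` \<Omega>"

end

theory Submission
  imports Defs "HOL-Computational_Algebra.Fundamental_Theorem_Algebra"
begin

text \<open>Both the gap and the weight margin are controlled by cofactors. Let \<open>A\<close> be an invertible
\<open>r \<times> r\<close> matrix whose rows have norm at most \<open>b\<close>. The vector of cofactors along a row of
\<open>A\<close> has norm at most \<open>b\<^sup>r\<^sup>-\<^sup>1\<close>: put this vector in place of the row, so that the determinant becomes the
square of its norm, and apply Hadamard's inequality. These vectors are the columns of
\<open>det A \<cdot> A\<^sup>-\<^sup>1\<close>. Hence \<open>\<bar>det A\<bar> \<bar>x\<bar> \<le> \<surd>r b\<^sup>r\<^sup>-\<^sup>1 \<bar>A x\<bar>\<close>, which bounds the singular values of \<open>A\<close>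
from below, and a combination of the rows of \<open>A\<close> with coefficients of sum 1 has norm at least
\<open>\<bar>det A\<bar> / (r b\<^sup>r\<^sup>-\<^sup>1)\<close>. As \<open>b \<ge> 1\<close>, the size \<open>r\<close> of a submatrix may be replaced by the number \<open>n\<close> of
columns in these bounds.

For the margin, let \<open>p\<close> be the point of \<open>conv \<Gamma>\<close> closest to the origin, \<open>p \<noteq> 0\<close>. A smallest set
\<open>S \<subseteq> \<Gamma>\<close> with \<open>p \<in> conv S\<close> is affinely independent (Caratheodory) and lies in the hyperplane
through \<open>p\<close> orthogonal to \<open>p\<close>, so it is linearly independent. Some \<open>\<bar>S\<bar>\<close> coordinates
therefore cut an invertible square submatrix out of the rows \<open>S\<close>, and restricting \<open>p\<close> to these
coordinates exhibits it as a combination of the rows of this submatrix with coefficients of sum 1.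
This proves the bound for every finite set of vectors
(\<open>weight_margin_lower_bound\<close>); what remains is to bound the subdeterminants of weight matrices.

For a product of general linear groups every phase matrix is in the maximal torus, because
adjoining a one-parameter group of phase matrices keeps a diagonal torus connected and commutative.
Restricted to one diagonal coordinate \<open>s\<close>, the representation is a Laurent polynomial
\<open>\<Sum>\<^sub>k s\<^sup>k\<^sup>-\<^sup>m C\<^sub>k\<close>. Multiplicativity forces the \<open>C\<^sub>k\<close> to be projections onto the subspaces on
which \<open>s\<close> acts by \<open>s\<^sup>k\<^sup>-\<^sup>m\<close>. So all weights are integral, there are finitely many of them, and all nonzero
subdeterminants have absolute value at least 1.

A weight \<open>\<omega>\<close> of the restriction to special linear groups extends to a weight of the whole
representation: applying the \<open>C\<^sub>k\<close> for all coordinates to a weight vector gives a vector on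
which the full torus acts by a weight \<open>\<alpha>\<close>, and the action of the smaller torus is not changed. Then
\<open>\<omega>\<close> is obtained from \<open>\<alpha>\<close> by subtracting block averages. This projection is orthogonal, hence
\<open>\<bar>\<omega>\<bar> \<le> \<bar>\<alpha>\<bar>\<close>, and the entries of \<open>R \<omega>\<close> are integers, hence the nonzero subdeterminants have
absolute value at least \<open>R\<^sup>-\<^sup>n\<close>.\<close>

section \<open>Hadamard's inequality and cofactors\<close>

definition pos_def :: "nat \<Rightarrow> real Matrix.mat \<Rightarrow> bool" where
  "pos_def n G \<longleftrightarrow> G \<in> carrier_mat n n \<and> (\<forall>i<n. \<forall>j<n. G $$ (i,j) = G $$ (j,i)) \<and>
     (\<forall>x :: nat \<Rightarrow> real. (\<exists>i<n. x i \<noteq> 0) \<longrightarrow> 0 < (\<Sum>i<n. \<Sum>j<n. x i * x j * G $$ (i,j)))"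

lemma pos_def_diag:
  assumes "pos_def n G" "k < n"
  shows "0 < G $$ (k,k)"
proof -
  define x :: "nat \<Rightarrow> real" where "x i = (if i = k then 1 else 0)" for i
  have "0 < (\<Sum>i<n. \<Sum>j<n. x i * x j * G $$ (i,j))"
    using assms unfolding pos_def_def x_def by force
  also have "\<dots> = (\<Sum>i<n. \<Sum>j<n. if j = k then if i = k then G $$ (k,k) else 0 else 0)"
    by (intro sum.cong refl) (simp add: x_def)
  also have "(\<Sum>i<n. \<Sum>j<n. if j = k then if i = k then G $$ (k,k) else 0 else 0) = G $$ (k,k)"
    using assms(2) by simp
  finally show ?thesis .
qed

definition schur_complement :: "nat \<Rightarrow> real Matrix.mat \<Rightarrow> real Matrix.mat" where
  "schur_complement n G =
     Matrix.mat n n (\<lambda>(i,j). G $$ (Suc i, Suc j) - G $$ (Suc i, 0) * G $$ (0, Suc j) / G $$ (0,0))"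

text \<open>One step of Gaussian elimination: \<open>G\<close> is the product of a lower triangular block matrix with
identity diagonal blocks and an upper triangular block matrix with diagonal blocks \<open>G\<^sub>0\<^sub>0\<close> and the Schur complement.\<close>

lemma det_schur_complement:
  assumes G: "G \<in> carrier_mat (Suc n) (Suc n)" and a: "G $$ (0,0) \<noteq> 0"
  shows "Determinant.det G = G $$ (0,0) * Determinant.det (schur_complement n G)"
proof -
  define L1 L2 L3 L4 where
    "L1 = (1\<^sub>m 1 :: real Matrix.mat)" and "L2 = (0\<^sub>m 1 n :: real Matrix.mat)" and
    "L3 = Matrix.mat n 1 (\<lambda>(i,j). G $$ (Suc i, 0) / G $$ (0,0))" and "L4 = (1\<^sub>m n :: real Matrix.mat)"
  define U1 U2 U3 U4 where
    "U1 = Matrix.mat 1 1 (\<lambda>(i,j). G $$ (0,0))" and "U2 = Matrix.mat 1 n (\<lambda>(i,j). G $$ (0, Suc j))" and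
    "U3 = (0\<^sub>m n 1 :: real Matrix.mat)" and "U4 = schur_complement n G"
  note dL = L1_def L2_def L3_def L4_def and dU = U1_def U2_def U3_def U4_def
  have cL: "L1 \<in> carrier_mat 1 1" "L2 \<in> carrier_mat 1 n" "L3 \<in> carrier_mat n 1" "L4 \<in> carrier_mat n n"
    by (auto simp: dL)
  have cU: "U1 \<in> carrier_mat 1 1" "U2 \<in> carrier_mat 1 n" "U3 \<in> carrier_mat n 1" "U4 \<in> carrier_mat n n"
    by (auto simp: dU schur_complement_def)
  have "four_block_mat L1 L2 L3 L4 * four_block_mat U1 U2 U3 U4 = G"
  proof (subst mult_four_block_mat[OF cL cU], rule eq_matI)
    fix i j assume ij: "i < dim_row G" "j < dim_col G"
    hence "i < Suc n" "j < Suc n" using G by auto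
    thus "four_block_mat (L1 * U1 + L2 * U3) (L1 * U2 + L2 * U4) (L3 * U1 + L4 * U3) (L3 * U2 + L4 * U4) $$ (i,j)
        = G $$ (i,j)"
      using a by (cases i; cases j)
        (auto simp: dL dU schur_complement_def scalar_prod_def)
  qed (use G in \<open>auto simp: dL dU schur_complement_def\<close>)
  hence "Determinant.det G = Determinant.det (four_block_mat L1 L2 L3 L4) * Determinant.det (four_block_mat U1 U2 U3 U4)"
    using det_mult[of "four_block_mat L1 L2 L3 L4" "1 + n" "four_block_mat U1 U2 U3 U4"] cL cU
    by (metis four_block_carrier_mat)
  also have "Determinant.det (four_block_mat L1 L2 L3 L4) = Determinant.det L1 * Determinant.det L4"
    by (rule det_four_block_mat_upper_right_zero[OF cL(1) L2_def cL(3,4)])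
  also have "Determinant.det (four_block_mat U1 U2 U3 U4) = Determinant.det U1 * Determinant.det U4"
    by (rule det_four_block_mat_lower_left_zero[OF cU(1,2) U3_def cU(4)])
  finally show ?thesis by (simp add: dL dU det_single)
qed

text \<open>The quadratic form of the Schur complement at \<open>x\<close> is the minimum over \<open>x\<^sub>0\<close> of the quadratic
form of \<open>G\<close> at \<open>(x\<^sub>0, x)\<close>.\<close>

lemma pos_def_schur_complement:
  assumes G: "pos_def (Suc n) G"
  shows "pos_def n (schur_complement n G)"
proof -
  define a where "a = G $$ (0,0)"
  define u where "u i = G $$ (Suc i, 0)" for i
  have a: "a > 0" using pos_def_diag[OF G, of 0] by (simp add: a_def)
  have sym: "G $$ (i,j) = G $$ (j,i)" if "i < Suc n" "j < Suc n" for i j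
    using G that unfolding pos_def_def by blast
  have S: "schur_complement n G $$ (i,j) = G $$ (Suc i, Suc j) - u i * u j / a" if "i < n" "j < n" for i j
    using that sym[of 0 "Suc j"] by (simp add: schur_complement_def a_def u_def)
  have "0 < (\<Sum>i<n. \<Sum>j<n. x i * x j * schur_complement n G $$ (i,j))" if x: "\<exists>i<n. x i \<noteq> 0" for x :: "nat \<Rightarrow> real"
  proof -
    define t where "t = (\<Sum>i<n. u i * x i)"
    \<comment> \<open>the value \<open>- t / a\<close> of the additional coordinate minimizes the quadratic form\<close>
    define y where "y = case_nat (- t / a) x"
    have "\<exists>i<Suc n. y i \<noteq> 0" using x unfolding y_def by (metis Suc_mono nat.simps(5))
    hence "0 < (\<Sum>i<Suc n. \<Sum>j<Suc n. y i * y j * G $$ (i,j))"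
      using G unfolding pos_def_def by blast
    also have "\<dots> = (- t / a) * (- t / a) * a + (\<Sum>j<n. (- t / a) * x j * G $$ (0, Suc j))
        + (\<Sum>i<n. x i * (- t / a) * u i + (\<Sum>j<n. x i * x j * G $$ (Suc i, Suc j)))"
      by (simp only: sum.lessThan_Suc_shift) (simp add: y_def a_def u_def)
    also have "(\<Sum>j<n. (- t / a) * x j * G $$ (0, Suc j)) = (- t / a) * t"
      unfolding t_def sum_distrib_left by (intro sum.cong refl) (use sym in \<open>auto simp: u_def\<close>)
    also have "(\<Sum>i<n. x i * (- t / a) * u i + (\<Sum>j<n. x i * x j * G $$ (Suc i, Suc j)))
       = (- t / a) * t + (\<Sum>i<n. \<Sum>j<n. x i * x j * G $$ (Suc i, Suc j))"
      unfolding t_def sum.distrib sum_distrib_left by (simp add: mult_ac)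
    also have "(- t / a) * (- t / a) * a + (- t / a) * t + ((- t / a) * t + (\<Sum>i<n. \<Sum>j<n. x i * x j * G $$ (Suc i, Suc j)))
       = (\<Sum>i<n. \<Sum>j<n. x i * x j * G $$ (Suc i, Suc j)) - t * t / a"
      using a by (simp add: field_simps)
    also have "t * t / a = (\<Sum>i<n. \<Sum>j<n. x i * x j * (u i * u j / a))"
      unfolding t_def sum_product sum_divide_distrib by (simp add: mult_ac)
    also have "(\<Sum>i<n. \<Sum>j<n. x i * x j * G $$ (Suc i, Suc j)) - \<dots>
       = (\<Sum>i<n. \<Sum>j<n. x i * x j * schur_complement n G $$ (i,j))"
      unfolding sum_subtractf[symmetric] by (intro sum.cong refl) (simp add: S algebra_simps)
    finally show ?thesis .
  qed
  thus ?thesis unfolding pos_def_def using sym by (auto simp: S mult_ac) (simp add: schur_complement_def)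
qed

text \<open>Passing to the Schur complement splits off the factor \<open>G\<^sub>0\<^sub>0\<close> of the determinant and subtracts
a nonnegative number from each of the other diagonal entries.\<close>

lemma pos_def_det_le_prod_diag:
  assumes "pos_def n G"
  shows "0 \<le> Determinant.det G" "Determinant.det G \<le> (\<Prod>i<n. G $$ (i,i))"
proof -
  have "0 \<le> Determinant.det G \<and> Determinant.det G \<le> (\<Prod>i<n. G $$ (i,i))" using assms
  proof (induction n arbitrary: G)
    case 0
    thus ?case by (simp add: pos_def_def)
  next
    case (Suc n)
    let ?S = "schur_complement n G"
    have G: "G \<in> carrier_mat (Suc n) (Suc n)" using Suc.prems by (simp add: pos_def_def)
    have a: "G $$ (0,0) > 0" using pos_def_diag[OF Suc.prems] by simp
    have S: "pos_def n ?S" by (rule pos_def_schur_complement[OF Suc.prems])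
    have "(\<Prod>i<n. ?S $$ (i,i)) \<le> (\<Prod>i<n. G $$ (Suc i, Suc i))"
    proof (rule prod_mono, safe)
      fix i assume i: "i < n"
      show "0 \<le> ?S $$ (i,i)" using pos_def_diag[OF S i] by simp
      have "G $$ (Suc i, 0) = G $$ (0, Suc i)" using Suc.prems i by (simp add: pos_def_def)
      thus "?S $$ (i,i) \<le> G $$ (Suc i, Suc i)" using i a by (simp add: schur_complement_def)
    qed
    hence "Determinant.det ?S \<le> (\<Prod>i<n. G $$ (Suc i, Suc i))" using Suc.IH[OF S] by linarith
    thus ?case using Suc.IH[OF S] a det_schur_complement[OF G]
      by (simp add: prod.lessThan_Suc_shift del: prod.lessThan_Suc)
  qed
  thus "0 \<le> Determinant.det G" "Determinant.det G \<le> (\<Prod>i<n. G $$ (i,i))" by auto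
qed

text \<open>The Gram matrix of the rows is positive definite unless the determinant vanishes. Its determinant
is the square of \<open>det A\<close>, and its diagonal entries are the squared norms of the rows.\<close>

theorem hadamard_inequality:
  assumes A: "A \<in> carrier_mat n n"
  shows "(Determinant.det A)\<^sup>2 \<le> (\<Prod>i<n. \<Sum>j<n. (A $$ (i,j) :: real)\<^sup>2)"
proof (cases "Determinant.det A = 0")
  case True
  thus ?thesis by (simp add: prod_nonneg sum_nonneg)
next
  case False
  define G where "G = A * transpose_mat A"
  have Gij: "G $$ (i,j) = (\<Sum>k<n. A $$ (i,k) * A $$ (j,k))" if "i < n" "j < n" for i j
    using A that by (auto simp: G_def scalar_prod_def atLeast0LessThan)
  have "pos_def n G" unfolding pos_def_def
  proof (intro conjI allI impI)
    show "G \<in> carrier_mat n n" using A by (simp add: G_def)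
    show "G $$ (i,j) = G $$ (j,i)" if "i < n" "j < n" for i j using that by (simp add: Gij mult.commute)
    fix x :: "nat \<Rightarrow> real" assume x: "\<exists>i<n. x i \<noteq> 0"
    define v where "v = Matrix.vec n x"
    have v: "v \<in> carrier_vec n" "v \<noteq> 0\<^sub>v n" using x by (auto simp: v_def vec_eq_iff)
    have "Determinant.det (transpose_mat A) \<noteq> 0" using False A by (simp add: det_transpose)
    hence "transpose_mat A *\<^sub>v v \<noteq> 0\<^sub>v n"
      using det_0_iff_vec_prod_zero[of "transpose_mat A" n] A v by auto
    then obtain k where k: "k < n" "(\<Sum>i<n. x i * A $$ (i,k)) \<noteq> 0"
      using A by (auto simp: vec_eq_iff v_def scalar_prod_def atLeast0LessThan mult.commute)
    have "0 < (\<Sum>k<n. (\<Sum>i<n. x i * A $$ (i,k))\<^sup>2)"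
      by (rule sum_pos2[of _ k]) (use k in auto)
    also have "\<dots> = (\<Sum>k<n. \<Sum>i<n. \<Sum>j<n. x i * x j * (A $$ (i,k) * A $$ (j,k)))"
      unfolding power2_eq_square sum_product by (simp add: mult_ac)
    also have "\<dots> = (\<Sum>i<n. \<Sum>k<n. \<Sum>j<n. x i * x j * (A $$ (i,k) * A $$ (j,k)))"
      by (rule sum.swap)
    also have "\<dots> = (\<Sum>i<n. \<Sum>j<n. \<Sum>k<n. x i * x j * (A $$ (i,k) * A $$ (j,k)))"
      by (intro sum.cong refl sum.swap)
    also have "\<dots> = (\<Sum>i<n. \<Sum>j<n. x i * x j * G $$ (i,j))"
      by (intro sum.cong refl) (simp add: Gij sum_distrib_left)
    finally show "0 < (\<Sum>i<n. \<Sum>j<n. x i * x j * G $$ (i,j))" .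
  qed
  from pos_def_det_le_prod_diag(2)[OF this]
  have "Determinant.det G \<le> (\<Prod>i<n. \<Sum>j<n. (A $$ (i,j))\<^sup>2)"
    by (simp add: Gij power2_eq_square)
  moreover have "Determinant.det G = (Determinant.det A)\<^sup>2"
    using det_mult[of A n "transpose_mat A"] A by (simp add: G_def det_transpose power2_eq_square)
  ultimately show ?thesis by simp
qed

text \<open>Replacing row \<open>j\<close> by its own cofactor vector \<open>c\<close> does not change the cofactors along
row \<open>j\<close>, so Laplace expansion gives the determinant \<open>\<bar>c\<bar>\<^sup>2\<close>, and Hadamard's inequality gives
\<open>\<bar>c\<bar>\<^sup>2 \<le> \<bar>c\<bar> b\<^sup>n\<^sup>-\<^sup>1\<close>.\<close>

lemma cofactor_row_bound:
  assumes A: "A \<in> carrier_mat n n" and j: "j < n"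
    and b: "\<And>i. i < n \<Longrightarrow> (\<Sum>k<n. (A $$ (i,k) :: real)\<^sup>2) \<le> b\<^sup>2"
  shows "(\<Sum>k<n. (cofactor A j k)\<^sup>2) \<le> (b ^ (n - 1))\<^sup>2"
proof -
  define B where "B = Matrix.mat n n (\<lambda>(i,k). if i = j then cofactor A j k else A $$ (i,k))"
  define s where "s = (\<Sum>k<n. (cofactor A j k)\<^sup>2)"
  have B: "B \<in> carrier_mat n n" by (simp add: B_def)
  have "mat_delete B j k = mat_delete A j k" if "k < n" for k
    unfolding mat_delete_def using A that j by (intro eq_matI) (auto simp: B_def)
  hence "cofactor B j k = cofactor A j k" if "k < n" for k
    using that by (simp add: cofactor_def)
  hence "Determinant.det B = s"
    using laplace_expansion_row[OF B j] j by (simp add: B_def s_def power2_eq_square)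
  with hadamard_inequality[OF B] have "s\<^sup>2 \<le> (\<Prod>i<n. \<Sum>k<n. (B $$ (i,k))\<^sup>2)" by simp
  also have "\<dots> = s * (\<Prod>i\<in>{..<n}-{j}. \<Sum>k<n. (B $$ (i,k))\<^sup>2)"
    using j by (subst prod.remove[of _ j]) (auto simp: B_def s_def)
  also have "(\<Prod>i\<in>{..<n}-{j}. \<Sum>k<n. (B $$ (i,k))\<^sup>2) = (\<Prod>i\<in>{..<n}-{j}. \<Sum>k<n. (A $$ (i,k))\<^sup>2)"
    by (intro prod.cong refl) (auto simp: B_def)
  also have "s * \<dots> \<le> s * (\<Prod>i\<in>{..<n}-{j}. b\<^sup>2)"
    by (intro mult_left_mono prod_mono) (use b in \<open>auto simp: s_def sum_nonneg\<close>)
  also have "(\<Prod>i\<in>{..<n}-{j}. b\<^sup>2) = (b ^ (n - 1))\<^sup>2"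
    using j by (simp add: power_mult[symmetric] mult.commute)
  finally have "s * s \<le> s * (b ^ (n - 1))\<^sup>2" by (simp add: power2_eq_square)
  moreover have "s \<ge> 0" by (simp add: s_def sum_nonneg)
  ultimately have "s \<le> (b ^ (n - 1))\<^sup>2"
    by (cases "s = 0") auto
  thus ?thesis by (simp add: s_def)
qed

section \<open>Singular values\<close>

text \<open>Multiplying \<open>A x\<close> by the adjugate gives \<open>det A \<cdot> x\<close>. The \<open>r\<close> columns of the adjugate have norm at
most \<open>b\<^sup>r\<^sup>-\<^sup>1\<close>, so its Frobenius norm is at most \<open>\<surd>r b\<^sup>r\<^sup>-\<^sup>1\<close>.\<close>

lemma cofactor_inverse_bound:
  assumes A: "A \<in> carrier_mat r r"
    and b: "\<And>i. i < r \<Longrightarrow> (\<Sum>k<r. (A $$ (i,k) :: real)\<^sup>2) \<le> b\<^sup>2"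
    and x: "x \<in> carrier_vec r"
  shows "(Determinant.det A)\<^sup>2 * (x \<bullet> x) \<le> real r * (b ^ (r - 1))\<^sup>2 * ((A *\<^sub>v x) \<bullet> (A *\<^sub>v x))"
proof -
  define y where "y = A *\<^sub>v x"
  have y: "y \<in> carrier_vec r" using A x by (simp add: y_def)
  note adj = adj_mat[OF A]
  have "adj_mat A *\<^sub>v y = (adj_mat A * A) *\<^sub>v x"
    unfolding y_def using assoc_mult_mat_vec[OF adj(1) A x] by simp
  hence eq: "adj_mat A *\<^sub>v y = (Determinant.det A \<cdot>\<^sub>m 1\<^sub>m r) *\<^sub>v x" by (simp add: adj(3))
  have dx: "Determinant.det A * vec_index x i = (\<Sum>k<r. cofactor A k i * vec_index y k)" if i: "i < r" for i
  proof -
    have "vec_index (adj_mat A *\<^sub>v y) i = (\<Sum>k<r. cofactor A k i * vec_index y k)"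
      using i A y by (simp add: adj_mat_def scalar_prod_def atLeast0LessThan)
    moreover have "vec_index ((Determinant.det A \<cdot>\<^sub>m 1\<^sub>m r) *\<^sub>v x) i = Determinant.det A * vec_index x i"
      using i x by simp
    ultimately show ?thesis by (simp add: eq)
  qed
  have "(Determinant.det A)\<^sup>2 * (x \<bullet> x) = (\<Sum>i<r. (Determinant.det A * vec_index x i)\<^sup>2)"
    using x by (simp add: scalar_prod_def atLeast0LessThan sum_distrib_left power2_eq_square mult_ac)
  also have "\<dots> \<le> (\<Sum>i<r. (\<Sum>k<r. (cofactor A k i)\<^sup>2) * (\<Sum>k<r. (vec_index y k)\<^sup>2))"
    by (intro sum_mono) (simp add: dx Cauchy_Schwarz_ineq_sum)
  also have "\<dots> = (\<Sum>i<r. \<Sum>k<r. (cofactor A k i)\<^sup>2) * (y \<bullet> y)"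
    using y by (simp add: sum_distrib_right scalar_prod_def atLeast0LessThan power2_eq_square)
  also have "(\<Sum>i<r. \<Sum>k<r. (cofactor A k i)\<^sup>2) = (\<Sum>k<r. \<Sum>i<r. (cofactor A k i)\<^sup>2)"
    by (rule sum.swap)
  also have "\<dots> * (y \<bullet> y) \<le> (\<Sum>k<r. (b ^ (r - 1))\<^sup>2) * (y \<bullet> y)"
    using cofactor_row_bound[OF A _ b] y
    by (intro mult_right_mono sum_mono) (auto simp: scalar_prod_def intro!: sum_nonneg)
  finally show ?thesis by (simp add: y_def)
qed

text \<open>The minimum of the singular values is only meaningful if there is one. The complex
characteristic polynomial has a root \<open>k\<close>; for an eigenvector \<open>v\<close> the equation
\<open>k \<bar>v\<bar>\<^sup>2 = \<bar>B v\<bar>\<^sup>2\<close> shows that \<open>k\<close> is real.\<close>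

lemma gram_matrix_real_eigenvalue:
  assumes B: "(B :: real Matrix.mat) \<in> carrier_mat r r" and r: "r > 0"
  shows "\<exists>k. eigenvalue (transpose_mat B * B) k"
proof -
  define S where "S = transpose_mat B * B"
  define CB where "CB = map_mat complex_of_real B"
  define C where "C = map_mat complex_of_real S"
  have S: "S \<in> carrier_mat r r" using B by (simp add: S_def)
  have C: "C \<in> carrier_mat r r" using S by (simp add: C_def)
  have "\<not> constant (poly (char_poly C))"
    using degree_monic_char_poly[OF C] r by (simp add: constant_degree)
  then obtain k where k: "eigenvalue C k"
    using fundamental_theorem_of_algebra[of "char_poly C"] eigenvalue_root_char_poly[OF C] by auto
  then obtain v where v: "v \<in> carrier_vec r" "v \<noteq> 0\<^sub>v r" "C *\<^sub>v v = k \<cdot>\<^sub>v v"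
    using C by (auto simp: eigenvalue_def eigenvector_def)
  have Sij: "S $$ (i,j) = (\<Sum>l<r. B $$ (l,i) * B $$ (l,j))" if "i < r" "j < r" for i j
    using that B by (simp add: S_def scalar_prod_def atLeast0LessThan)
  let ?v = "vec_index v"
  have kv: "k * ?v i = (\<Sum>j<r. complex_of_real (S $$ (i,j)) * ?v j)" if "i < r" for i
    using arg_cong[OF v(3), of "\<lambda>w. vec_index w i"] that v(1) S
    by (simp add: C_def scalar_prod_def atLeast0LessThan)
  define w where "w l = (\<Sum>i<r. complex_of_real (B $$ (l,i)) * ?v i)" for l
  have "k * (\<Sum>i<r. ?v i * cnj (?v i)) = (\<Sum>i<r. (k * ?v i) * cnj (?v i))"
    by (simp add: sum_distrib_left mult_ac)
  also have "\<dots> = (\<Sum>i<r. \<Sum>j<r. \<Sum>l<r. complex_of_real (B $$ (l,i)) * cnj (?v i) * (complex_of_real (B $$ (l,j)) * ?v j))"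
    by (intro sum.cong refl) (simp add: kv Sij sum_distrib_left sum_distrib_right mult_ac)
  also have "\<dots> = (\<Sum>i<r. \<Sum>l<r. \<Sum>j<r. complex_of_real (B $$ (l,i)) * cnj (?v i) * (complex_of_real (B $$ (l,j)) * ?v j))"
    by (intro sum.cong refl sum.swap)
  also have "\<dots> = (\<Sum>l<r. \<Sum>i<r. \<Sum>j<r. complex_of_real (B $$ (l,i)) * cnj (?v i) * (complex_of_real (B $$ (l,j)) * ?v j))"
    by (rule sum.swap)
  also have "\<dots> = (\<Sum>l<r. cnj (w l) * w l)"
    by (simp add: w_def sum_product)
  also have "\<dots> = complex_of_real (\<Sum>l<r. (cmod (w l))\<^sup>2)"
    unfolding of_real_sum by (intro sum.cong refl) (simp only: complex_norm_square mult.commute)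
  finally have eq: "k * complex_of_real (\<Sum>i<r. (cmod (?v i))\<^sup>2) = complex_of_real (\<Sum>l<r. (cmod (w l))\<^sup>2)"
    unfolding of_real_sum complex_norm_square by simp
  obtain i0 where "i0 < r" "?v i0 \<noteq> 0" using v(1,2) by (auto simp: vec_eq_iff)
  hence pos: "(\<Sum>i<r. (cmod (?v i))\<^sup>2) > 0" by (intro sum_pos2[of _ i0]) auto
  define q where "q = (\<Sum>l<r. (cmod (w l))\<^sup>2) / (\<Sum>i<r. (cmod (?v i))\<^sup>2)"
  have kq: "k = complex_of_real q"
    using eq pos unfolding q_def of_real_divide by (metis less_irrefl nonzero_eq_divide_eq of_real_eq_0_iff)
  have "poly (char_poly C) k = 0" using k eigenvalue_root_char_poly[OF C] by simp
  hence "complex_of_real (poly (char_poly S) q) = 0"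
    unfolding C_def kq of_real_hom.char_poly_hom[OF S] by (simp add: of_real_hom.poly_map_poly)
  hence "eigenvalue S q" using eigenvalue_root_char_poly[OF S] by simp
  thus ?thesis by (auto simp: S_def)
qed

lemma singular_values_finite_nonempty:
  assumes B: "(B :: real Matrix.mat) \<in> carrier_mat r r" and r: "r > 0"
  shows "finite (singular_values B)" "singular_values B \<noteq> {}"
proof -
  have S: "transpose_mat B * B \<in> carrier_mat r r" using B by simp
  have "char_poly (transpose_mat B * B) \<noteq> 0" using degree_monic_char_poly[OF S] by auto
  hence "finite {k. eigenvalue (transpose_mat B * B) k}"
    using poly_roots_finite eigenvalue_root_char_poly[OF S] by simp
  moreover have "singular_values B = sqrt ` {k. eigenvalue (transpose_mat B * B) k}"
    by (auto simp: singular_values_def)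
  ultimately show "finite (singular_values B)" by simp
  show "singular_values B \<noteq> {}"
    using gram_matrix_real_eigenvalue[OF assms] by (auto simp: singular_values_def)
qed

lemma singular_value_lower_bound:
  assumes A: "A \<in> carrier_mat r r"
    and b: "\<And>i. i < r \<Longrightarrow> (\<Sum>k<r. (A $$ (i,k) :: real)\<^sup>2) \<le> b\<^sup>2" and b0: "b > 0"
    and s: "s \<in> singular_values A"
  shows "\<bar>Determinant.det A\<bar> \<le> s * sqrt (real r) * b ^ (r - 1)"
proof -
  obtain k v where k: "s = sqrt k" "v \<in> carrier_vec r" "v \<noteq> 0\<^sub>v r" "(transpose_mat A * A) *\<^sub>v v = k \<cdot>\<^sub>v v"
    using s A by (auto simp: singular_values_def eigenvalue_def eigenvector_def)
  have "(A *\<^sub>v v) \<bullet> (A *\<^sub>v v) = v \<bullet> (transpose_mat A *\<^sub>v (A *\<^sub>v v))"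
    using transpose_vec_mult_scalar[OF A k(2), of "A *\<^sub>v v"] A k(2)
    by (metis comm_scalar_prod mult_mat_vec_carrier transpose_carrier_mat)
  also have "\<dots> = v \<bullet> (k \<cdot>\<^sub>v v)"
    using k(4) A k(2) by (metis assoc_mult_mat_vec transpose_carrier_mat)
  also have "\<dots> = k * (v \<bullet> v)" using k(2) by simp
  finally have nAv: "(A *\<^sub>v v) \<bullet> (A *\<^sub>v v) = k * (v \<bullet> v)" .
  obtain i0 where i0: "i0 < r" "vec_index v i0 \<noteq> 0" using k(2,3) by (auto simp: vec_eq_iff)
  have "v \<bullet> v = (\<Sum>i<r. vec_index v i * vec_index v i)" using k(2) by (simp add: scalar_prod_def atLeast0LessThan)
  also have "\<dots> > 0" using i0 by (intro sum_pos2[of _ i0]) (auto simp: zero_less_mult_iff)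
  finally have vv: "v \<bullet> v > 0" .
  have "(Determinant.det A)\<^sup>2 * (v \<bullet> v) \<le> (real r * (b ^ (r - 1))\<^sup>2 * k) * (v \<bullet> v)"
    using cofactor_inverse_bound[OF A b k(2)] by (simp add: nAv mult_ac)
  hence "(Determinant.det A)\<^sup>2 \<le> real r * (b ^ (r - 1))\<^sup>2 * k" using vv by simp
  hence "sqrt ((Determinant.det A)\<^sup>2) \<le> sqrt (real r * (b ^ (r - 1))\<^sup>2 * k)" by (rule real_sqrt_le_mono)
  thus ?thesis using b0 by (simp add: k(1) real_sqrt_mult mult_ac)
qed

section \<open>Invertible submatrices and the gap\<close>

lemma bij_betw_pick:
  assumes "finite S"
  shows "bij_betw (pick S) {..<card S} S"
proof -
  have inj: "inj_on (pick S) {..<card S}"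
  proof (rule inj_onI)
    fix x y assume "x \<in> {..<card S}" "y \<in> {..<card S}" "pick S x = pick S y"
    thus "x = y" by (metis card_pick_le lessThan_iff)
  qed
  moreover have "pick S ` {..<card S} \<subseteq> S" using pick_in_set_le by blast
  ultimately have "pick S ` {..<card S} = S"
    using assms by (metis card_image card_lessThan card_subset_eq)
  thus ?thesis unfolding bij_betw_def using inj by blast
qed

lemma invertible_mat_iff_det:
  assumes A: "(A :: 'a :: field Matrix.mat) \<in> carrier_mat r r"
  shows "invertible_mat A \<longleftrightarrow> Determinant.det A \<noteq> 0"
proof
  assume "invertible_mat A"
  then obtain B where B: "A * B = 1\<^sub>m r" "B * A = 1\<^sub>m (dim_row B)"
    using A by (auto simp: invertible_mat_def inverts_mat_def)
  have "dim_col B = r" using arg_cong[OF B(1), of dim_col] A by simp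
  moreover have "dim_row B = r" using arg_cong[OF B(2), of dim_col] A by simp
  ultimately have "B \<in> carrier_mat r r" by auto
  hence "Determinant.det A * Determinant.det B = 1" using det_mult[OF A, of B] B(1) by simp
  thus "Determinant.det A \<noteq> 0" by auto
next
  assume d: "Determinant.det A \<noteq> 0"
  define B where "B = inverse (Determinant.det A) \<cdot>\<^sub>m adj_mat A"
  note adj = adj_mat[OF A]
  have "A * B = 1\<^sub>m r" unfolding B_def
    using d adj(2) by (subst mult_smult_distrib[OF A adj(1)]) auto
  moreover have "B * A = 1\<^sub>m r" unfolding B_def
    using d adj(3) by (subst mult_smult_assoc_mat[OF adj(1) A]) auto
  ultimately show "invertible_mat A"
    using A adj(1) unfolding invertible_mat_def inverts_mat_def by (auto simp: B_def)
qed

lemma submatrix_carrier: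
  assumes "M \<in> carrier_mat m n" "I \<subseteq> {..<m}" "J \<subseteq> {..<n}"
  shows "submatrix M I J \<in> carrier_mat (card I) (card J)"
    and "\<And>i j. i < card I \<Longrightarrow> j < card J \<Longrightarrow> submatrix M I J $$ (i,j) = M $$ (pick I i, pick J j)"
proof -
  have "{i. i < m \<and> i \<in> I} = I" "{j. j < n \<and> j \<in> J} = J" using assms by auto
  thus "submatrix M I J \<in> carrier_mat (card I) (card J)"
    "\<And>i j. i < card I \<Longrightarrow> j < card J \<Longrightarrow> submatrix M I J $$ (i,j) = M $$ (pick I i, pick J j)"
    using assms(1) by (auto simp: submatrix_def)
qed

lemma invertible_submatricesE:
  assumes M: "M \<in> carrier_mat m n" and A: "A \<in> invertible_submatrices M"
  obtains I J r where "I \<subseteq> {..<m}" "J \<subseteq> {..<n}" "card I = r" "card J = r" "0 < r" "r \<le> n"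
    "A = submatrix M I J" "A \<in> carrier_mat r r" "Determinant.det A \<noteq> 0"
proof -
  obtain I J where IJ: "I \<subseteq> {..<m}" "J \<subseteq> {..<n}" "card I = card J" "I \<noteq> {}" "A = submatrix M I J"
    "invertible_mat A"
    using A M by (auto simp: invertible_submatrices_def)
  have "finite I" using IJ(1) finite_subset by auto
  hence "0 < card I" using IJ(4) by (simp add: card_gt_0_iff)
  moreover have "card J \<le> n" using card_mono[OF _ IJ(2)] by simp
  moreover have "A \<in> carrier_mat (card I) (card I)" using submatrix_carrier(1)[OF M IJ(1,2)] IJ by simp
  ultimately show ?thesis using that[of I J "card I"] IJ invertible_mat_iff_det by metis
qed

lemma invertible_submatricesI:
  assumes "M \<in> carrier_mat m n" "I \<subseteq> {..<m}" "J \<subseteq> {..<n}" "card I = card J" "0 < card I"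
    "Determinant.det (submatrix M I J) \<noteq> 0"
  shows "submatrix M I J \<in> invertible_submatrices M"
proof -
  have "submatrix M I J \<in> carrier_mat (card I) (card I)"
    using submatrix_carrier(1)[OF assms(1-3)] assms(4) by simp
  hence "invertible_mat (submatrix M I J)" using assms(6) invertible_mat_iff_det by blast
  moreover have "I \<noteq> {}" using assms(5) by auto
  ultimately show ?thesis using assms(1-4) unfolding invertible_submatrices_def by blast
qed

lemma finite_invertible_submatrices: "finite (invertible_submatrices M)"
proof -
  have "invertible_submatrices M \<subseteq> (\<lambda>(I,J). submatrix M I J) ` (Pow {..<dim_row M} \<times> Pow {..<dim_col M})"
    unfolding invertible_submatrices_def by auto
  thus ?thesis by (rule finite_subset) auto
qed

lemma invertible_submatrices_nonempty:
  assumes M: "M \<in> carrier_mat m n" "M \<noteq> 0\<^sub>m m n"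
  shows "invertible_submatrices M \<noteq> {}"
proof -
  obtain i j where ij: "i < m" "j < n" "M $$ (i,j) \<noteq> 0" using M by (auto simp: mat_eq_iff)
  have c: "submatrix M {i} {j} \<in> carrier_mat 1 1"
    using submatrix_carrier(1)[OF M(1), of "{i}" "{j}"] ij by simp
  have p: "pick {k} 0 = k" for k :: nat by (auto intro: Least_equality)
  have "submatrix M {i} {j} $$ (0,0) = M $$ (i,j)"
    using submatrix_carrier(2)[OF M(1), of "{i}" "{j}" 0 0] ij by (simp add: p[simplified])
  hence "Determinant.det (submatrix M {i} {j}) \<noteq> 0" using ij det_single[OF c] by simp
  thus ?thesis using invertible_submatricesI[OF M(1), of "{i}" "{j}"] ij by auto
qed

lemma submatrix_row_bound:
  assumes M: "M \<in> carrier_mat m n" and I: "I \<subseteq> {..<m}" and J: "J \<subseteq> {..<n}"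
    and b: "\<forall>i<m. l2norm (Matrix.row M i) \<le> b" and i: "i < card I"
  shows "(\<Sum>k<card J. (submatrix M I J $$ (i,k))\<^sup>2) \<le> b\<^sup>2"
proof -
  have fin: "finite I" "finite J" using I J finite_subset by auto
  have pi: "pick I i < m" using pick_in_set_le[OF i] I by auto
  have "(\<Sum>k<card J. (submatrix M I J $$ (i,k))\<^sup>2) = (\<Sum>k<card J. (M $$ (pick I i, pick J k))\<^sup>2)"
    using submatrix_carrier(2)[OF M I J i] by simp
  also have "\<dots> = (\<Sum>k\<in>J. (M $$ (pick I i, k))\<^sup>2)"
    by (rule sum.reindex_bij_betw[OF bij_betw_pick[OF fin(2)]])
  also have "\<dots> \<le> (\<Sum>k<n. (M $$ (pick I i, k))\<^sup>2)" by (rule sum_mono2) (use J in auto)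
  also have "\<dots> = (l2norm (Matrix.row M (pick I i)))\<^sup>2"
    using M pi by (simp add: l2norm_def scalar_prod_def atLeast0LessThan power2_eq_square sum_nonneg)
  also have "\<dots> \<le> b\<^sup>2"
    using b pi M by (intro power_mono) (auto simp: l2norm_def scalar_prod_def intro!: sum_nonneg)
  finally show ?thesis .
qed

lemma powi_one_minus: "n > 0 \<Longrightarrow> (b::real) powi (1 - int n) = inverse (b ^ (n - 1))"
proof -
  assume "n > 0"
  hence "1 - int n = - int (n - 1)" by simp
  thus ?thesis by (simp only: power_int_minus power_int_of_nat)
qed

lemma min_subdet_le:
  assumes "A \<in> invertible_submatrices M"
  shows "min_subdet M \<le> \<bar>Determinant.det A\<bar>"
  unfolding min_subdet_def using assms finite_invertible_submatrices by (intro Min_le) auto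

theorem gap_lower_bound:
  assumes M: "M \<in> carrier_mat m n" "M \<noteq> 0\<^sub>m m n" and b1: "1 \<le> b"
    and b: "\<forall>i<m. l2norm (Matrix.row M i) \<le> b"
  shows "min_subdet M * b powi (1 - int n) * real n powr (- 1 / 2) \<le> gap M"
proof -
  have "min_subdet M * b powi (1 - int n) * real n powr (- 1 / 2) \<le> s"
    if B: "B \<in> invertible_submatrices M" and s: "s \<in> singular_values B" for B s
  proof -
    obtain I J r where IJ: "I \<subseteq> {..<m}" "J \<subseteq> {..<n}" "card I = r" "card J = r" "0 < r" "r \<le> n"
      "B = submatrix M I J" "B \<in> carrier_mat r r" "Determinant.det B \<noteq> 0"
      using invertible_submatricesE[OF M(1) B] .
    have det_le: "\<bar>Determinant.det B\<bar> \<le> s * sqrt (real r) * b ^ (r - 1)"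
      using singular_value_lower_bound[OF IJ(8) _ _ s, of b] submatrix_row_bound[OF M(1) IJ(1,2) b] IJ b1
      by auto
    moreover have "0 < \<bar>Determinant.det B\<bar>" using IJ(9) by simp
    ultimately have "0 < s * (sqrt (real r) * b ^ (r - 1))" by (simp add: mult.assoc)
    moreover have "0 < sqrt (real r) * b ^ (r - 1)" using IJ(5) b1 by simp
    ultimately have s0: "0 < s" by (rule zero_less_mult_pos2)
    have "min_subdet M \<le> s * (sqrt (real r) * b ^ (r - 1))"
      using min_subdet_le[OF B] det_le by (simp add: mult.assoc)
    also have "\<dots> \<le> s * (sqrt (real n) * b ^ (n - 1))"
      using s0 IJ(5,6) b1 by (intro mult_left_mono mult_mono power_increasing) auto
    finally have le: "min_subdet M \<le> s * (sqrt (real n) * b ^ (n - 1))" .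
    have pos: "0 < sqrt (real n) * b ^ (n - 1)" using IJ(5,6) b1 by simp
    have "real n powr (- 1 / 2) = inverse (sqrt (real n))"
      by (simp only: minus_divide_left[symmetric] powr_minus) (simp add: powr_half_sqrt)
    hence eq: "b powi (1 - int n) * real n powr (- 1 / 2) = inverse (sqrt (real n) * b ^ (n - 1))"
      using powi_one_minus[of n b] IJ(5,6) by simp
    have "min_subdet M * b powi (1 - int n) * real n powr (- 1 / 2)
        = min_subdet M / (sqrt (real n) * b ^ (n - 1))"
      by (simp only: mult.assoc eq divide_inverse[of "min_subdet M"])
    also have "\<dots> \<le> s" using le pos by (simp only: pos_divide_le_eq)
    finally show ?thesis .
  qed
  moreover have "finite (singular_values B)" "singular_values B \<noteq> {}"
    if "B \<in> invertible_submatrices M" for B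
    using invertible_submatricesE[OF M(1) that] singular_values_finite_nonempty by metis+
  ultimately show ?thesis unfolding gap_def
    using finite_invertible_submatrices invertible_submatrices_nonempty[OF M] by simp
qed

section \<open>Points of smallest norm in convex hulls\<close>

text \<open>The scalar product of \<open>y = \<Sum>\<^sub>i c\<^sub>i A\<^sub>i\<close> with the cofactor vector of row \<open>j\<close> is
\<open>det A \<cdot> c\<^sub>j\<close>, which bounds each \<open>c\<^sub>j\<close> separately.\<close>

lemma row_combination_bound:
  assumes A: "A \<in> carrier_mat r r"
    and b: "\<And>i. i < r \<Longrightarrow> (\<Sum>k<r. (A $$ (i,k) :: real)\<^sup>2) \<le> b\<^sup>2" and b0: "b \<ge> 0"
    and y: "\<And>j. j < r \<Longrightarrow> y j = (\<Sum>i<r. c i * A $$ (i,j))"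
  shows "\<bar>Determinant.det A\<bar> * \<bar>\<Sum>i<r. c i\<bar> \<le> real r * b ^ (r - 1) * sqrt (\<Sum>j<r. (y j)\<^sup>2)"
proof -
  note adj = adj_mat[OF A]
  have cy: "Determinant.det A * c j = (\<Sum>k<r. y k * cofactor A j k)" if j: "j < r" for j
  proof -
    have "(\<Sum>k<r. y k * cofactor A j k) = (\<Sum>k<r. \<Sum>i<r. c i * (A $$ (i,k) * cofactor A j k))"
      by (intro sum.cong refl) (simp add: y sum_distrib_left mult_ac)
    also have "\<dots> = (\<Sum>i<r. c i * (\<Sum>k<r. A $$ (i,k) * cofactor A j k))"
      by (subst sum.swap) (simp add: sum_distrib_left)
    also have "\<dots> = (\<Sum>i<r. c i * ((A * adj_mat A) $$ (i,j)))"
      using A j by (intro sum.cong refl) (simp add: adj_mat_def scalar_prod_def atLeast0LessThan)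
    also have "\<dots> = (\<Sum>i<r. if i = j then c j * Determinant.det A else 0)"
      using j by (intro sum.cong refl) (auto simp: adj(2))
    also have "\<dots> = Determinant.det A * c j" using j by (simp add: mult.commute)
    finally show ?thesis by simp
  qed
  have each: "\<bar>Determinant.det A\<bar> * \<bar>c j\<bar> \<le> b ^ (r - 1) * sqrt (\<Sum>k<r. (y k)\<^sup>2)" if j: "j < r" for j
  proof -
    have "(Determinant.det A * c j)\<^sup>2 \<le> (\<Sum>k<r. (y k)\<^sup>2) * (\<Sum>k<r. (cofactor A j k)\<^sup>2)"
      unfolding cy[OF j] by (rule Cauchy_Schwarz_ineq_sum)
    also have "\<dots> \<le> (\<Sum>k<r. (y k)\<^sup>2) * (b ^ (r - 1))\<^sup>2"
      by (intro mult_left_mono cofactor_row_bound[OF A j b] sum_nonneg) auto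
    finally have "sqrt ((Determinant.det A * c j)\<^sup>2) \<le> sqrt ((\<Sum>k<r. (y k)\<^sup>2) * (b ^ (r - 1))\<^sup>2)"
      by (rule real_sqrt_le_mono)
    thus ?thesis using b0 by (simp add: real_sqrt_mult abs_mult mult_ac)
  qed
  have "\<bar>Determinant.det A\<bar> * \<bar>\<Sum>i<r. c i\<bar> \<le> (\<Sum>i<r. \<bar>Determinant.det A\<bar> * \<bar>c i\<bar>)"
    unfolding sum_distrib_left[symmetric] by (intro mult_left_mono sum_abs) auto
  also have "\<dots> \<le> (\<Sum>i<r. b ^ (r - 1) * sqrt (\<Sum>k<r. (y k)\<^sup>2))"
    by (intro sum_mono each) auto
  finally show ?thesis by simp
qed

text \<open>The closest point \<open>p\<close> satisfies \<open>\<langle>s, p\<rangle> \<ge> \<bar>p\<bar>\<^sup>2\<close> for all \<open>s \<in> \<Gamma>\<close>, with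
equality where \<open>p\<close> has a positive coefficient. A smallest support \<open>S\<close> of \<open>p\<close> is affinely
independent and has only positive coefficients, so it lies in the affine hyperplane
\<open>\<langle>s, p\<rangle> = \<bar>p\<bar>\<^sup>2\<close>; there, linear relations are affine relations.\<close>

lemma closest_point_independent_support:
  fixes \<Gamma> :: "'a::euclidean_space set"
  assumes fin: "finite \<Gamma>" and p: "p \<in> convex hull \<Gamma>" "p \<noteq> 0"
    and closest: "\<And>x. x \<in> convex hull \<Gamma> \<Longrightarrow> norm p \<le> norm x"
  obtains S u where "finite S" "S \<subseteq> \<Gamma>" "independent S" "sum u S = 1" "(\<Sum>s\<in>S. u s *\<^sub>R s) = p"
proof -
  define P where "P S \<longleftrightarrow> finite S \<and> S \<subseteq> \<Gamma> \<and> p \<in> convex hull S" for S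
  have "P \<Gamma>" using fin p by (simp add: P_def)
  then obtain S where S: "P S" and min: "\<And>S'. P S' \<Longrightarrow> card S \<le> card S'"
    using arg_min_natI[of P \<Gamma> card] arg_min_nat_le[of P _ card] by blast
  have fS: "finite S" and SG: "S \<subseteq> \<Gamma>" and pS: "p \<in> convex hull S" using S by (auto simp: P_def)
  obtain u where u: "\<forall>s\<in>S. 0 \<le> u s" "sum u S = 1" "(\<Sum>s\<in>S. u s *\<^sub>R s) = p"
    using pS convex_hull_finite[OF fS] by auto
  have upos: "0 < u s" if s: "s \<in> S" for s
  proof (rule ccontr)
    assume "\<not> 0 < u s"
    hence us: "u s = 0" using u(1) s by force
    have "p \<in> convex hull (S - {s})"
      unfolding convex_hull_finite[OF finite_Diff[OF fS]]
      using u us s fS by (auto intro!: exI[of _ u] simp: sum_diff1)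
    hence "P (S - {s})" using fS SG by (auto simp: P_def)
    from min[OF this] show False using card_Diff1_less[OF fS s] by linarith
  qed
  have ge: "p \<bullet> p \<le> s \<bullet> p" if s: "s \<in> \<Gamma>" for s
  proof -
    have "inner (0 - p) (s - p) \<le> 0"
      by (rule any_closest_point_dot[of "convex hull \<Gamma>"])
        (use fin p s closest in \<open>auto simp: hull_inc compact_imp_closed finite_imp_compact_convex_hull\<close>)
    thus ?thesis by (simp add: inner_diff_right inner_commute)
  qed
  have "(\<Sum>s\<in>S. u s * (s \<bullet> p - p \<bullet> p)) = (\<Sum>s\<in>S. u s *\<^sub>R s) \<bullet> p - sum u S * (p \<bullet> p)"
    by (simp add: inner_sum_left sum_distrib_right sum_subtractf algebra_simps)
  also have "\<dots> = 0" using u by simp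
  finally have "(\<Sum>s\<in>S. u s * (s \<bullet> p - p \<bullet> p)) = 0" .
  moreover have "0 \<le> u s * (s \<bullet> p - p \<bullet> p)" if "s \<in> S" for s
    using u(1) ge SG that by (intro mult_nonneg_nonneg) auto
  ultimately have "\<forall>s\<in>S. u s * (s \<bullet> p - p \<bullet> p) = 0"
    using fS by (simp add: sum_nonneg_eq_0_iff)
  hence eq: "s \<bullet> p = p \<bullet> p" if "s \<in> S" for s using upos that by force
  have "independent S"
  proof
    assume "dependent S"
    then obtain c where c: "\<exists>v\<in>S. c v \<noteq> 0" "(\<Sum>v\<in>S. c v *\<^sub>R v) = 0"
      using dependent_finite[OF fS] by blast
    have "0 = (\<Sum>v\<in>S. c v *\<^sub>R v) \<bullet> p" using c by simp
    also have "\<dots> = (\<Sum>v\<in>S. c v * (p \<bullet> p))" unfolding inner_sum_left by (intro sum.cong) (simp_all add: eq)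
    also have "\<dots> = sum c S * (p \<bullet> p)" by (simp add: sum_distrib_right)
    finally have "sum c S = 0" using p(2) by simp
    hence "affine_dependent S" using c affine_dependent_explicit_finite[OF fS] by blast
    \<comment> \<open>Caratheodory gives a smaller support\<close>
    hence "aff_dim S + 1 < card S"
      using fS affine_independent_iff_card[of S] aff_dim_le_card[OF fS] by auto
    moreover obtain S' where "finite S'" "S' \<subseteq> S" "card S' \<le> aff_dim S + 1" "p \<in> convex hull S'"
      using pS caratheodory_aff_dim[of S] by auto
    moreover have "card S \<le> card S'" using calculation SG by (intro min) (auto simp: P_def)
    ultimately show False by linarith
  qed
  thus ?thesis using that[of S u] fS SG u by auto
qed

text \<open>Extend \<open>S\<close> to a basis by unit vectors. The remaining coordinates \<open>J\<close> suffice: a combination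
of \<open>S\<close> that vanishes on \<open>J\<close> is a combination of the added unit vectors.\<close>

lemma independent_rows_pivot_columns:
  fixes S :: "(real^'n) set"
  assumes ind: "independent S"
  obtains J :: "'n set" where "card J = card S"
    "\<And>c. (\<And>j. j \<in> J \<Longrightarrow> (\<Sum>s\<in>S. c s * s $ j) = 0) \<Longrightarrow> (\<And>s. s \<in> S \<Longrightarrow> c s = 0)"
proof -
  obtain B where B: "S \<subseteq> B" "B \<subseteq> S \<union> Basis" "independent B" "S \<union> Basis \<subseteq> span B"
    using maximal_independent_subset_extend[of S "S \<union> Basis"] ind by auto
  have fB: "finite B" using B(3) independent_imp_finite by blast
  have fS: "finite S" using B(1) fB finite_subset by blast
  have "span B = UNIV" using B(4) span_Basis span_mono span_span by (metis UNIV_I le_sup_iff subsetI subset_antisym)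
  hence cB: "card B = CARD('n)" using B(3) dim_span_eq_card_independent[of B] by simp
  define ax :: "'n \<Rightarrow> real^'n" where "ax k = axis k 1" for k
  define K where "K = {k. ax k \<in> B - S}"
  have "B - S \<subseteq> range ax" using B(2) by (auto simp: Basis_vec_def ax_def)
  hence BS: "B - S = ax ` K" by (auto simp: K_def)
  have "inj ax" by (auto simp: inj_def ax_def axis_eq_axis)
  hence "card K = card (B - S)" using BS by (metis card_image inj_on_subset subset_UNIV)
  hence "card K = CARD('n) - card S" using cB B(1) fS by (simp add: card_Diff_subset)
  moreover have "card (- K) = CARD('n) - card K" by (simp add: Compl_eq_Diff_UNIV card_Diff_subset)
  moreover have "card S \<le> CARD('n)" using cB B(1) fB card_mono by metis
  ultimately have cJ: "card (- K) = card S" by simp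
  have "c s = 0" if z: "\<And>j. j \<in> - K \<Longrightarrow> (\<Sum>s\<in>S. c s * s $ j) = 0" and s: "s \<in> S" for c s
  proof -
    define v where "v = (\<Sum>s\<in>S. c s *\<^sub>R s)"
    have vz: "v $ j = 0" if "j \<notin> K" for j using z[of j] that by (simp add: v_def)
    have "v = (\<Sum>k\<in>UNIV. v $ k *\<^sub>R ax k)" unfolding Finite_Cartesian_Product.vec_eq_iff
    proof
      fix i
      have "(\<Sum>k\<in>UNIV. v $ k *\<^sub>R ax k) $ i = (\<Sum>k\<in>UNIV. if k = i then v $ i else 0)"
        unfolding sum_component by (intro sum.cong) (auto simp: ax_def axis_def)
      thus "v $ i = (\<Sum>k\<in>UNIV. v $ k *\<^sub>R ax k) $ i" by simp
    qed
    also have "\<dots> = (\<Sum>k\<in>K. v $ k *\<^sub>R ax k)" by (rule sum.mono_neutral_right) (auto simp: vz)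
    also have "\<dots> = (\<Sum>k\<in>K. (v \<bullet> ax k) *\<^sub>R ax k)" by (simp add: ax_def inner_axis)
    also have "\<dots> = (\<Sum>x\<in>ax ` K. (v \<bullet> x) *\<^sub>R x)"
      using \<open>inj ax\<close> by (subst sum.reindex) (auto intro: inj_on_subset)
    finally have v: "v = (\<Sum>x\<in>B - S. (v \<bullet> x) *\<^sub>R x)" by (simp add: BS)
    \<comment> \<open>the coefficients of the relation \<open>v - v = 0\<close> between the basis vectors\<close>
    define d where "d x = (if x \<in> S then c x else - (v \<bullet> x))" for x
    have "(\<Sum>x\<in>B. d x *\<^sub>R x) = (\<Sum>x\<in>B - S. d x *\<^sub>R x) + (\<Sum>x\<in>S. d x *\<^sub>R x)"
      using sum.subset_diff[OF B(1) fB] by blast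
    also have "(\<Sum>x\<in>B - S. d x *\<^sub>R x) = - (\<Sum>x\<in>B - S. (v \<bullet> x) *\<^sub>R x)"
      unfolding sum_negf[symmetric] by (intro sum.cong) (auto simp: d_def)
    also have "\<dots> = - v" using v by simp
    also have "(\<Sum>x\<in>S. d x *\<^sub>R x) = v" by (simp add: d_def v_def)
    finally have "(\<Sum>x\<in>B. d x *\<^sub>R x) = 0" by simp
    hence "d s = 0" using B(1,3) s dependent_finite[OF fB] by blast
    thus ?thesis using s by (simp add: d_def)
  qed
  thus ?thesis using that[of "- K"] cJ by blast
qed

text \<open>The point \<open>p\<close> of \<open>conv \<Gamma>\<close> closest to 0 is a convex combination of independent rows of \<open>M\<close>.
Let \<open>A\<close> be the invertible submatrix formed by these rows and by pivot columns for them. The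
restriction of \<open>p\<close> to the pivot columns is the same convex combination of the rows of \<open>A\<close>.\<close>

lemma weight_margin_lower_bound:
  fixes \<Omega> :: "(real^'n) set"
  assumes wm: "is_weight_matrix \<Omega> M" and b1: "1 \<le> b"
    and b: "\<forall>i<dim_row M. l2norm (Matrix.row M i) \<le> b"
    and \<delta>: "\<And>A. A \<in> invertible_submatrices M \<Longrightarrow> \<delta> \<le> \<bar>Determinant.det A\<bar>"
  shows "ereal (\<delta> * b powi (1 - int CARD('n)) * inverse (real CARD('n))) \<le> weight_margin \<Omega>"
proof -
  define n where "n = CARD('n)"
  define m where "m = dim_row M"
  define e :: "nat \<Rightarrow> 'n" where "e = from_nat_into UNIV"
  define e' :: "'n \<Rightarrow> nat" where "e' = to_nat_on UNIV"
  have n0: "n > 0" by (simp add: n_def)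
  have ee': "e (e' k) = k" for k by (simp add: e_def e'_def countable_finite)
  have e'n: "e' k < n" for k
    using to_nat_on_finite[of "UNIV :: 'n set"] by (auto simp: e'_def n_def bij_betw_def)
  have inje': "inj e'" using ee' by (metis injI)
  have M: "M \<in> carrier_mat m n" using wm by (auto simp: is_weight_matrix_def m_def n_def)
  \<comment> \<open>the rows of \<open>M\<close> as elements of \<open>\<Omega>\<close>; \<open>e\<close> and \<open>e'\<close> translate between column numbers and coordinates\<close>
  define rw :: "nat \<Rightarrow> real^'n" where "rw i = (\<chi> k. M $$ (i, e' k))" for i
  have cv: "vec_index (coordinate_vec \<omega>) (e' k) = \<omega> $ k" for \<omega> :: "real^'n" and k
    using e'n[of k] ee'[of k] by (simp add: coordinate_vec_def n_def e_def)
  have rwcv: "rw i = \<omega>" if "i < m" "Matrix.row M i = coordinate_vec \<omega>" for i \<omega>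
  proof -
    have "M $$ (i, e' k) = \<omega> $ k" for k
      using cv[of \<omega> k] that M e'n[of k] by (metis carrier_matD index_row(1))
    thus ?thesis by (simp add: rw_def Finite_Cartesian_Product.vec_eq_iff)
  qed
  have inj_row: "i = j" if "i < m" "j < m" "Matrix.row M i = Matrix.row M j" for i j
    using wm that M by (auto simp: is_weight_matrix_def distinct_conv_nth)
  have rows_ex: "\<exists>i<m. Matrix.row M i = coordinate_vec \<omega>" if "\<omega> \<in> \<Omega>" for \<omega>
  proof -
    have "coordinate_vec \<omega> \<in> set (Matrix.rows M)" using wm that by (auto simp: is_weight_matrix_def)
    thus ?thesis by (auto simp: Matrix.rows_def m_def)
  qed
  have fin\<Omega>: "finite \<Omega>"
  proof (rule finite_subset)
    show "\<Omega> \<subseteq> rw ` {..<m}" using rows_ex rwcv by blast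
  qed auto
  have "\<delta> * b powi (1 - int n) * inverse (real n) \<le> infdist 0 (convex hull \<Gamma>)"
    if G: "\<Gamma> \<noteq> {}" "\<Gamma> \<subseteq> \<Omega>" "0 \<notin> convex hull \<Gamma>" for \<Gamma>
  proof -
    have finG: "finite \<Gamma>" using G(2) fin\<Omega> finite_subset by blast
    hence cl: "closed (convex hull \<Gamma>)" by (simp add: compact_imp_closed finite_imp_compact_convex_hull)
    obtain p where p: "p \<in> convex hull \<Gamma>" "infdist 0 (convex hull \<Gamma>) = dist 0 p"
      using infdist_attains_inf[OF cl, of 0] G(1) by auto
    have closest: "norm p \<le> norm x" if "x \<in> convex hull \<Gamma>" for x
      using infdist_le[OF that, of 0] p(2) by simp
    have "p \<noteq> 0" using p G by auto
    obtain S u where S: "finite S" "S \<subseteq> \<Gamma>" "independent S" "sum u S = 1" "(\<Sum>s\<in>S. u s *\<^sub>R s) = p"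
      using closest_point_independent_support[OF finG p(1) \<open>p \<noteq> 0\<close> closest] by blast
    obtain J where J: "card J = card S"
      "\<And>c s. (\<And>j. j \<in> J \<Longrightarrow> (\<Sum>s\<in>S. c s * s $ j) = 0) \<Longrightarrow> s \<in> S \<Longrightarrow> c s = 0"
      using independent_rows_pivot_columns[OF S(3)] by blast
    define r where "r = card S"
    define I where "I = {i. i < m \<and> Matrix.row M i \<in> coordinate_vec ` S}"
    define J' where "J' = e' ` J"
    have rwI: "bij_betw rw I S"
    proof (rule bij_betwI')
      fix i j assume "i \<in> I" "j \<in> I"
      thus "rw i = rw j \<longleftrightarrow> i = j" using rwcv inj_row unfolding I_def by (metis (mono_tags, lifting) imageE mem_Collect_eq)
    next
      fix i assume "i \<in> I" thus "rw i \<in> S" using rwcv by (auto simp: I_def)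
    next
      fix s assume "s \<in> S" thus "\<exists>i\<in>I. s = rw i"
        using rows_ex[of s] rwcv[of _ s] S(2) G(2) unfolding I_def by blast
    qed
    have cI: "card I = r" using rwI bij_betw_same_card r_def by blast
    have Im: "I \<subseteq> {..<m}" by (auto simp: I_def)
    have J'n: "J' \<subseteq> {..<n}" using e'n by (auto simp: J'_def)
    have cJ': "card J' = r" using inje' J(1) unfolding J'_def r_def by (metis card_image inj_on_subset subset_UNIV)
    have finIJ: "finite I" "finite J'" using Im J'n finite_subset by auto
    have "S \<noteq> {}" using S(4) by auto
    hence r0: "r > 0" using S(1) by (simp add: r_def card_gt_0_iff)
    define A where "A = submatrix M I J'"
    have A: "A \<in> carrier_mat r r" using submatrix_carrier(1)[OF M Im J'n] cI cJ' by (simp add: A_def)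
    \<comment> \<open>\<open>h\<close> and \<open>q\<close> number \<open>S\<close> and \<open>J\<close> in the order of the rows and columns of \<open>A\<close>\<close>
    define h where "h i = rw (pick I i)" for i
    define q where "q j = e (pick J' j)" for j
    have h: "bij_betw h {..<r} S"
      using bij_betw_trans[OF bij_betw_pick[OF finIJ(1)] rwI] cI by (simp add: h_def[abs_def] comp_def)
    have "bij_betw e J' J" unfolding bij_betw_def J'_def
      by (auto simp: inj_on_def ee' image_iff)
    hence q: "bij_betw q {..<r} J"
      using bij_betw_trans[OF bij_betw_pick[OF finIJ(2)]] cJ' by (auto simp: q_def[abs_def] comp_def)
    have Aij: "A $$ (i,j) = h i $ q j" if ij: "i < r" "j < r" for i j
    proof -
      have "pick J' j \<in> e' ` J" using pick_in_set_le[of j J'] ij cJ' by (simp add: J'_def)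
      hence "e' (q j) = pick J' j" by (auto simp: q_def ee')
      thus ?thesis using submatrix_carrier(2)[OF M Im J'n, of i j] ij cI cJ'
        by (simp add: A_def h_def rw_def)
    qed
    have comb: "(\<Sum>i<r. c (h i) * A $$ (i,j)) = (\<Sum>s\<in>S. c s * s $ q j)" if "j < r" for c j
      using sum.reindex_bij_betw[OF h, of "\<lambda>s. c s * s $ q j"] that by (simp add: Aij)
    have detA: "Determinant.det A \<noteq> 0"
    proof
      assume "Determinant.det A = 0"
      hence "Determinant.det (transpose_mat A) = 0" using A by (simp add: det_transpose)
      then obtain v where v: "v \<in> carrier_vec r" "v \<noteq> 0\<^sub>v r" "transpose_mat A *\<^sub>v v = 0\<^sub>v r"
        using det_0_iff_vec_prod_zero[of "transpose_mat A" r] A by auto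
      define c where "c s = vec_index v (inv_into {..<r} h s)" for s
      have ch: "c (h i) = vec_index v i" if "i < r" for i
        using that h by (simp add: c_def bij_betw_def)
      have "(\<Sum>s\<in>S. c s * s $ k) = 0" if "k \<in> J" for k
      proof -
        obtain j where j: "j < r" "k = q j" using \<open>k \<in> J\<close> q by (auto simp: bij_betw_def)
        have "(\<Sum>s\<in>S. c s * s $ k) = (\<Sum>i<r. vec_index v i * A $$ (i,j))"
          unfolding j(2) comb[OF j(1), symmetric] by (simp add: ch)
        also have "\<dots> = vec_index (transpose_mat A *\<^sub>v v) j"
          using A v(1) j by (simp add: scalar_prod_def atLeast0LessThan mult.commute)
        finally show ?thesis using v(3) j by simp
      qed
      hence "c s = 0" if "s \<in> S" for s using J(2) that by blast
      hence "vec_index v i = 0" if "i < r" for i using ch[OF that] h that by (auto simp: bij_betw_def)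
      thus False using v(1,2) by (auto simp: vec_eq_iff)
    qed
    have "A \<in> invertible_submatrices M"
      using invertible_submatricesI[OF M Im J'n] cI cJ' r0 detA by (simp add: A_def)
    hence dA: "\<delta> \<le> \<bar>Determinant.det A\<bar>" by (rule \<delta>)
    have rowA: "(\<Sum>k<r. (A $$ (i,k))\<^sup>2) \<le> b\<^sup>2" if "i < r" for i
      using submatrix_row_bound[OF M Im J'n _ , of b i] b that cI cJ' by (simp add: A_def m_def)
    have pq: "p $ q j = (\<Sum>i<r. u (h i) * A $$ (i,j))" if "j < r" for j
      using S(5) comb[OF that, of u] by auto
    have "(\<Sum>i<r. u (h i)) = 1" using sum.reindex_bij_betw[OF h, of u] S(4) by simp
    hence "\<bar>Determinant.det A\<bar> \<le> real r * b ^ (r - 1) * sqrt (\<Sum>j<r. (p $ q j)\<^sup>2)"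
      using row_combination_bound[OF A rowA _ pq] b1 by simp
    also have "(\<Sum>j<r. (p $ q j)\<^sup>2) = (\<Sum>k\<in>J. (p $ k)\<^sup>2)"
      by (rule sum.reindex_bij_betw[OF q])
    also have "sqrt \<dots> \<le> norm p"
      unfolding norm_vec_def L2_set_def by (intro real_sqrt_le_mono) (auto intro!: sum_mono2)
    also have "real r * b ^ (r - 1) * norm p \<le> real n * b ^ (n - 1) * norm p"
    proof -
      have "r \<le> n" using card_mono[OF _ J'n] cJ' by simp
      thus ?thesis using b1 by (intro mult_right_mono mult_mono power_increasing) auto
    qed
    finally have "\<bar>Determinant.det A\<bar> \<le> real n * b ^ (n - 1) * norm p"
      using b1 by (simp add: mult_left_mono)
    hence "\<delta> \<le> norm p * (real n * b ^ (n - 1))" using dA by (simp add: mult_ac)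
    moreover have "\<delta> * b powi (1 - int n) * inverse (real n) = \<delta> / (real n * b ^ (n - 1))"
      using n0 by (simp add: powi_one_minus divide_inverse mult_ac)
    ultimately show ?thesis using n0 b1 p(2) by (simp add: pos_divide_le_eq)
  qed
  thus ?thesis unfolding weight_margin_def n_def by (intro INF_greatest) auto
qed

section \<open>Sets of vectors with bounded denominators\<close>

text \<open>The determinant of the integral matrix \<open>R \<cdot> A\<close> is a nonzero integer, namely \<open>R\<^sup>r det A\<close>.\<close>

lemma det_scaled_integral_lower_bound:
  fixes A :: "real Matrix.mat"
  assumes A: "A \<in> carrier_mat r r" and R: "R > 0" and rn: "r \<le> n"
    and int: "\<And>i j. i < r \<Longrightarrow> j < r \<Longrightarrow> real R * A $$ (i,j) \<in> \<int>" and d: "Determinant.det A \<noteq> 0"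
  shows "real R powi (- int n) \<le> \<bar>Determinant.det A\<bar>"
proof -
  have c: "real R \<cdot>\<^sub>m A \<in> carrier_mat r r" using A by simp
  have "Determinant.det (real R \<cdot>\<^sub>m A) \<in> \<int>"
    unfolding Determinant.det_def'[OF c]
  proof (intro Ints_sum Ints_mult Ints_prod)
    fix p i assume p: "p \<in> {p. p permutes {0..<r}}" and i: "i \<in> {0..<r}"
    hence "p i < r" using permutes_in_image[of p "{0..<r}" i] by auto
    thus "(real R \<cdot>\<^sub>m A) $$ (i, p i) \<in> \<int>" using int i A by simp
  qed simp
  hence "real R ^ r * Determinant.det A \<in> \<int>" using A by (simp add: det_smult)
  moreover have "real R ^ r * Determinant.det A \<noteq> 0" using R d by simp
  ultimately have "1 \<le> \<bar>real R ^ r * Determinant.det A\<bar>" by (rule Ints_nonzero_abs_ge1)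
  also have "\<dots> = real R ^ r * \<bar>Determinant.det A\<bar>" using R by (simp add: abs_mult)
  also have "\<dots> \<le> real R ^ n * \<bar>Determinant.det A\<bar>"
    using R rn by (intro mult_right_mono power_increasing) auto
  finally have "1 \<le> real R ^ n * \<bar>Determinant.det A\<bar>" .
  hence "inverse (real R ^ n) \<le> \<bar>Determinant.det A\<bar>" using R by (simp add: field_simps)
  thus ?thesis by (simp only: power_int_minus power_int_of_nat)
qed

lemma weight_matrix_exists:
  fixes \<Omega> :: "(real^'n) set"
  assumes "finite \<Omega>"
  obtains M where "is_weight_matrix \<Omega> M"
proof -
  obtain xs where xs: "set xs = coordinate_vec ` \<Omega>" "distinct xs"
    using finite_distinct_list[of "coordinate_vec ` \<Omega>"] assms by auto
  define M where "M = mat_of_rows CARD('n) xs"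
  have "set xs \<subseteq> carrier_vec CARD('n)" using xs by (auto simp: coordinate_vec_def)
  hence "Matrix.rows M = xs" unfolding M_def by (rule rows_mat_of_rows)
  hence "is_weight_matrix \<Omega> M" using xs by (simp add: is_weight_matrix_def M_def)
  thus ?thesis using that by blast
qed

lemma l2norm_coordinate_vec: "l2norm (coordinate_vec \<omega>) = norm (\<omega> :: real^'n)"
proof -
  have "(\<Sum>j<CARD('n). (\<omega> $ from_nat_into UNIV j)\<^sup>2) = (\<Sum>i\<in>UNIV. (\<omega> $ i)\<^sup>2)"
    by (rule sum.reindex_bij_betw[OF bij_betw_from_nat_into_finite]) simp
  thus ?thesis
    by (simp add: l2norm_def coordinate_vec_def scalar_prod_def atLeast0LessThan norm_vec_def L2_set_def power2_eq_square)
qed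

lemma weight_margin_trivial:
  assumes "\<Omega> \<subseteq> {0}"
  shows "weight_margin \<Omega> = \<infinity>"
proof -
  have empty: "{\<Gamma>. \<Gamma> \<noteq> {} \<and> \<Gamma> \<subseteq> \<Omega> \<and> 0 \<notin> convex hull \<Gamma>} = {}"
  proof -
    have "0 \<in> convex hull \<Gamma>" if "\<Gamma> \<noteq> {}" "\<Gamma> \<subseteq> \<Omega>" for \<Gamma>
    proof -
      have "\<Gamma> = {0}" using that assms by blast
      thus ?thesis by simp
    qed
    thus ?thesis by blast
  qed
  show ?thesis unfolding weight_margin_def empty by (simp add: top_ereal_def)
qed

text \<open>All entries of \<open>R \<cdot> M\<close> are integers if \<open>M\<close> is a weight matrix of \<open>\<Omega>\<close>, so the
subdeterminants of \<open>M\<close> are bounded from below.\<close>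

lemma weight_margin_scaled_integral:
  fixes \<Omega> :: "(real^'n) set"
  assumes fin: "finite \<Omega>" and R: "R > 0"
    and int: "\<And>\<omega> j. \<omega> \<in> \<Omega> \<Longrightarrow> real R * \<omega> $ j \<in> \<int>"
    and b: "\<And>\<omega>. \<omega> \<in> \<Omega> \<Longrightarrow> norm \<omega> \<le> b" and b1: "1 \<le> b"
  shows "ereal (real R powi (- int CARD('n)) * b powi (1 - int CARD('n)) * inverse (real CARD('n)))
    \<le> weight_margin \<Omega>"
proof -
  obtain M where M: "is_weight_matrix \<Omega> M" using weight_matrix_exists[OF fin] .
  have dimM: "dim_col M = CARD('n)" using M by (simp add: is_weight_matrix_def)
  have Mc: "M \<in> carrier_mat (dim_row M) CARD('n)" using dimM by (rule carrier_matI[OF refl])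
  have rowM: "\<exists>\<omega>\<in>\<Omega>. Matrix.row M i = coordinate_vec \<omega>" if "i < dim_row M" for i
  proof -
    have "Matrix.row M i \<in> set (Matrix.rows M)" using that by (auto simp: Matrix.rows_def)
    thus ?thesis using M by (auto simp: is_weight_matrix_def)
  qed
  show ?thesis
  proof (rule weight_margin_lower_bound[OF M b1])
    show "\<forall>i<dim_row M. l2norm (Matrix.row M i) \<le> b"
      using rowM b l2norm_coordinate_vec by metis
    fix A assume A: "A \<in> invertible_submatrices M"
    obtain I J r where IJ: "I \<subseteq> {..<dim_row M}" "J \<subseteq> {..<CARD('n)}" "card I = r" "card J = r" "0 < r"
      "r \<le> CARD('n)" "A = submatrix M I J" "A \<in> carrier_mat r r" "Determinant.det A \<noteq> 0"
      using invertible_submatricesE[OF Mc A] .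
    show "real R powi (- int CARD('n)) \<le> \<bar>Determinant.det A\<bar>"
    proof (rule det_scaled_integral_lower_bound[OF IJ(8) R IJ(6) _ IJ(9)])
      fix i j assume ij: "i < r" "j < r"
      have p: "pick I i < dim_row M" "pick J j < CARD('n)"
        using pick_in_set_le[of i I] pick_in_set_le[of j J] ij IJ(1-4) by auto
      obtain \<omega> where \<omega>: "\<omega> \<in> \<Omega>" "Matrix.row M (pick I i) = coordinate_vec \<omega>" using rowM[OF p(1)] by blast
      have "A $$ (i,j) = M $$ (pick I i, pick J j)"
        using submatrix_carrier(2)[OF Mc IJ(1,2)] ij IJ(3,4,7) by simp
      also have "\<dots> = vec_index (Matrix.row M (pick I i)) (pick J j)"
        using p dimM by (intro index_row(1)[symmetric]) simp_all
      also have "\<dots> = \<omega> $ from_nat_into UNIV (pick J j)"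
        unfolding \<omega>(2) coordinate_vec_def by (rule index_vec[OF p(2)])
      finally show "real R * A $$ (i,j) \<in> \<int>" using int[OF \<omega>(1)] by simp
    qed
  qed
qed

lemma integral_norm_ge_1:
  fixes \<omega> :: "real^'n"
  assumes "\<And>j. \<omega> $ j \<in> \<int>" "\<omega> \<noteq> 0"
  shows "1 \<le> norm \<omega>"
proof -
  obtain j where "\<omega> $ j \<noteq> 0" using assms(2) by (auto simp: Finite_Cartesian_Product.vec_eq_iff)
  hence "1 \<le> \<bar>\<omega> $ j\<bar>" using Ints_nonzero_abs_ge1 assms(1) by blast
  thus ?thesis using component_le_norm_cart[of \<omega> j] by linarith
qed

section \<open>Exponentials of diagonal matrices\<close>

definition cdiag :: "('n \<Rightarrow> complex) \<Rightarrow> complex^'n^'n::finite" where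
  "cdiag z = (\<chi> i j. if i = j then z i else 0)"

lemma cdiag_nth [simp]: "cdiag z $ i $ j = (if i = j then z i else 0)"
  by (simp add: cdiag_def)

lemma mult_cdiag_nth: "(A ** cdiag z) $ i $ j = A $ i $ j * z j"
proof -
  have "(A ** cdiag z) $ i $ j = (\<Sum>k\<in>UNIV. if k = j then A $ i $ j * z j else 0)"
    unfolding matrix_matrix_mult_def by (simp only: vec_lambda_beta, intro sum.cong) auto
  thus ?thesis by simp
qed

lemma cdiag_mult: "cdiag z ** cdiag y = cdiag (\<lambda>i. z i * y i)"
  by (simp add: Finite_Cartesian_Product.vec_eq_iff mult_cdiag_nth)

lemma cdiag_one: "cdiag (\<lambda>_. 1) = Finite_Cartesian_Product.mat 1"
  by (simp add: Finite_Cartesian_Product.vec_eq_iff Finite_Cartesian_Product.mat_def)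

lemma cdiag_eq_iff: "cdiag z = cdiag y \<longleftrightarrow> z = y"
  by (auto simp: Finite_Cartesian_Product.vec_eq_iff fun_eq_iff)

lemma diagonal_imp_cdiag:
  "\<forall>i j. i \<noteq> j \<longrightarrow> A $ i $ j = 0 \<Longrightarrow> A = cdiag (\<lambda>i. A $ i $ i)"
  by (auto simp: Finite_Cartesian_Product.vec_eq_iff)

lemma cdiag_invertible:
  assumes "\<forall>i. z i \<noteq> 0"
  shows "invertible (cdiag z)"
proof -
  have "(\<lambda>i. z i * inverse (z i)) = (\<lambda>_. 1)" "(\<lambda>i. inverse (z i) * z i) = (\<lambda>_. 1)"
    using assms by auto
  hence "cdiag z ** cdiag (\<lambda>i. inverse (z i)) = Finite_Cartesian_Product.mat 1"
    "cdiag (\<lambda>i. inverse (z i)) ** cdiag z = Finite_Cartesian_Product.mat 1"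
    by (simp_all only: cdiag_mult cdiag_one)
  thus ?thesis unfolding invertible_def by blast
qed

lemma det_cdiag: "Determinants.det (cdiag z) = (\<Prod>i\<in>UNIV. z i)"
  by (subst Determinants.det_diagonal) auto

lemma real_diag_cdiag: "real_diag \<omega> = cdiag (\<lambda>i. complex_of_real (\<omega> $ i))"
  by (simp add: Finite_Cartesian_Product.vec_eq_iff real_diag_def)

lemma map_matrix_cdiag: "f 0 = 0 \<Longrightarrow> map_matrix f (cdiag z) = cdiag (\<lambda>i. f (z i))"
  by (simp add: Finite_Cartesian_Product.vec_eq_iff)

lemma scaleR_cdiag: "t *\<^sub>R cdiag z = cdiag (\<lambda>i. t *\<^sub>R z i)"
  by (simp add: Finite_Cartesian_Product.vec_eq_iff)

definition mpow :: "complex^'n^'n \<Rightarrow> nat \<Rightarrow> complex^'n^'n::finite" where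
  "mpow A k = ((**) A ^^ k) (Finite_Cartesian_Product.mat 1)"

lemma mpow_0: "mpow A 0 = Finite_Cartesian_Product.mat 1"
  and mpow_Suc: "mpow A (Suc k) = A ** mpow A k"
  by (simp_all add: mpow_def)

lemma mpow_cdiag: "mpow (cdiag z) k = cdiag (\<lambda>i. z i ^ k)"
  by (induction k) (simp_all add: mpow_0 mpow_Suc cdiag_one[symmetric] cdiag_mult)

lemma mpow_scaleR: "mpow (t *\<^sub>R A) k = (t ^ k) *\<^sub>R mpow A k"
proof (induction k)
  case (Suc k)
  thus ?case by (simp add: mpow_Suc Finite_Cartesian_Product.vec_eq_iff matrix_matrix_mult_def scaleR_sum_right mult.commute[of t])
qed (simp add: mpow_0)

lemma mpow_entry_bound:
  fixes A :: "complex^'n^'n"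
  assumes c: "\<And>i j. cmod (A $ i $ j) \<le> c"
  shows "cmod (mpow A k $ i $ j) \<le> (real CARD('n) * c) ^ k"
proof (induction k arbitrary: i j)
  case 0
  show ?case by (simp add: mpow_0 Finite_Cartesian_Product.mat_def)
next
  case (Suc k)
  have c0: "0 \<le> c" using order_trans[OF norm_ge_zero c] .
  have "cmod (mpow A (Suc k) $ i $ j) \<le> (\<Sum>l\<in>UNIV. cmod (A $ i $ l * mpow A k $ l $ j))"
    by (simp add: mpow_Suc matrix_matrix_mult_def norm_sum)
  also have "\<dots> \<le> (\<Sum>l\<in>(UNIV::'n set). c * (real CARD('n) * c) ^ k)"
    unfolding norm_mult by (intro sum_mono mult_mono c Suc.IH) (use c0 in auto)
  finally show ?case by (simp add: mult_ac)
qed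

lemma summable_mexp_entry:
  "summable (\<lambda>k. (1 / fact k) *\<^sub>R (mpow A k $ i $ j))"
proof -
  obtain c where c: "\<And>i j. cmod (A $ i $ j) \<le> c"
  proof
    show "cmod (A $ i $ j) \<le> norm A" for i j
      by (meson Finite_Cartesian_Product.norm_nth_le order_trans)
  qed
  show ?thesis
  proof (rule summable_comparison_test')
    show "summable (\<lambda>k. (1 / fact k) *\<^sub>R (real CARD('a) * c) ^ k)"
      using summable_exp[of "real CARD('a) * c"] by (simp add: divide_inverse)
    show "norm ((1 / fact k) *\<^sub>R (mpow A k $ i $ j)) \<le> (1 / fact k) *\<^sub>R (real CARD('a) * c) ^ k" for k
      using mpow_entry_bound[OF c, of k i j] by (simp add: divide_right_mono)
  qed
qed

lemma mexp_entry: "mexp A $ i $ j = (\<Sum>k. (1 / fact k) *\<^sub>R (mpow A k $ i $ j))"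
proof -
  define B where "B = (\<chi> i j. \<Sum>k. (1 / fact k) *\<^sub>R (mpow A k $ i $ j))"
  have "(\<lambda>k. (1 / fact k) *\<^sub>R mpow A k) sums B"
    unfolding sums_def
  proof (intro vec_tendstoI)
    fix i j
    show "(\<lambda>n. (\<Sum>k<n. (1 / fact k) *\<^sub>R mpow A k) $ i $ j) \<longlonglongrightarrow> B $ i $ j"
      using summable_sums[OF summable_mexp_entry[of A i j]] by (simp add: sums_def B_def)
  qed
  hence "mexp A = B" by (simp add: mexp_def mpow_def sums_unique[symmetric])
  thus ?thesis by (simp add: B_def)
qed

lemma mexp_cdiag: "mexp (cdiag z) = cdiag (\<lambda>i. exp (z i))"
proof -
  have "mexp (cdiag z) $ i $ j = cdiag (\<lambda>i. exp (z i)) $ i $ j" for i j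
    by (cases "i = j") (simp_all add: mexp_entry mpow_cdiag exp_def divide_inverse)
  thus ?thesis by (simp add: Finite_Cartesian_Product.vec_eq_iff)
qed

text \<open>The entry of \<open>mexp (t X)\<close> at \<open>(i, j)\<close> is a power series in \<open>t\<close> with linear coefficient
\<open>X\<^sub>i\<^sub>j\<close>. It vanishes identically, and so do its coefficients.\<close>

lemma mexp_entry_zero_imp_entry_zero:
  assumes "\<And>t::real. mexp (t *\<^sub>R X) $ i $ j = 0"
  shows "X $ i $ j = 0"
proof -
  define a where "a k = (1 / fact k) *\<^sub>R (mpow X k $ i $ j)" for k
  have s: "summable (\<lambda>k. t ^ k *\<^sub>R a k)" and z: "(\<Sum>k. t ^ k *\<^sub>R a k) = 0" for t :: real
    using summable_mexp_entry[of "t *\<^sub>R X" i j] assms mexp_entry[of "t *\<^sub>R X" i j]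
    by (simp_all add: mpow_scaleR a_def mult.commute)
  \<comment> \<open>the parameter \<open>t\<close> is real, so the series is split into real and imaginary part\<close>
  have real_part_zero: "f (a 1) = 0" if f: "bounded_linear f" for f :: "complex \<Rightarrow> real"
  proof -
    have sums: "(\<lambda>k. f (a k) * t ^ k) sums 0" for t
      using bounded_linear.sums[OF f summable_sums[OF s[of t]]] z[of t]
      by (simp add: linear_simps[OF f] mult.commute)
    have "DERIV (\<lambda>t. \<Sum>k. f (a k) * t ^ k) 0 :> (\<Sum>k. diffs (\<lambda>k. f (a k)) k * 0 ^ k)"
      by (rule termdiffs_strong[of _ 1]) (use sums_summable[OF sums[of 1]] in auto)
    moreover have "(\<lambda>t. \<Sum>k. f (a k) * t ^ k) = (\<lambda>t. 0)" using sums_unique[OF sums] by auto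
    ultimately have "DERIV (\<lambda>t. 0) (0::real) :> f (a 1)" by (simp add: diffs_def)
    thus ?thesis using DERIV_unique DERIV_const by blast
  qed
  have "a 1 = 0"
    using real_part_zero[OF bounded_linear_Re] real_part_zero[OF bounded_linear_Im]
    by (simp add: complex_eq_iff)
  thus ?thesis by (simp add: a_def mpow_def)
qed

section \<open>Maximal tori\<close>

lemma group_GL: "group (GL :: (complex^'n^'n) monoid)"
proof (rule groupI)
  fix x y z :: "complex^'n^'n"
  show "x \<otimes>\<^bsub>GL\<^esub> y \<in> carrier GL" if "x \<in> carrier GL" "y \<in> carrier GL"
    using that by (simp add: GL_def invertible_mult)
  show "x \<otimes>\<^bsub>GL\<^esub> y \<otimes>\<^bsub>GL\<^esub> z = x \<otimes>\<^bsub>GL\<^esub> (y \<otimes>\<^bsub>GL\<^esub> z)" by (simp add: GL_def matrix_mul_assoc)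
  show "\<one>\<^bsub>GL\<^esub> \<otimes>\<^bsub>GL\<^esub> x = x" by (simp add: GL_def)
  show "\<exists>y\<in>carrier GL. y \<otimes>\<^bsub>GL\<^esub> x = \<one>\<^bsub>GL\<^esub>" if x: "x \<in> carrier GL"
  proof -
    obtain y where "x ** y = Finite_Cartesian_Product.mat 1" "y ** x = Finite_Cartesian_Product.mat 1"
      using x by (auto simp: GL_def invertible_def)
    thus ?thesis by (intro bexI[of _ y]) (auto simp: GL_def invertible_def)
  qed
next
  show "\<one>\<^bsub>GL\<^esub> \<in> carrier (GL :: (complex^'n^'n) monoid)"
    using cdiag_invertible[of "\<lambda>_. 1"] by (simp add: GL_def cdiag_one)
qed

lemma cdiag_unitary: "cdiag z \<in> unitary_group \<longleftrightarrow> (\<forall>i. cnj (z i) * z i = 1)"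
proof -
  have "ctranspose (cdiag z) = cdiag (\<lambda>i. cnj (z i))"
    by (simp add: ctranspose_def Finite_Cartesian_Product.vec_eq_iff)
  thus ?thesis by (simp add: unitary_group_def cdiag_mult cdiag_one[symmetric] cdiag_eq_iff fun_eq_iff)
qed

text \<open>The unitary diagonal matrices, parametrized by their angles.\<close>

definition phase :: "('n \<Rightarrow> real) \<Rightarrow> complex^'n^'n::finite" where
  "phase \<theta> = cdiag (\<lambda>i. exp (\<i> * complex_of_real (\<theta> i)))"

lemma phase_add: "phase \<theta> ** phase \<eta> = phase (\<lambda>i. \<theta> i + \<eta> i)"
  by (simp add: phase_def cdiag_mult exp_add[symmetric] algebra_simps)

lemma phase_unitary: "phase \<theta> \<in> unitary_group"
  by (simp add: phase_def cdiag_unitary exp_cnj exp_minus flip: exp_add)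

lemma maximal_torus_diagonal:
  "diagonal_maximal_torus G T \<Longrightarrow> t \<in> T \<Longrightarrow> t = cdiag (\<lambda>i. t $ i $ i)"
  by (rule diagonal_imp_cdiag) (auto simp: diagonal_maximal_torus_def)

text \<open>The products of
elements of \<open>T\<close> and of the one-parameter group are diagonal, so they form a commutative subgroup of
\<open>G \<inter> U(n)\<close>, which is connected as a continuous image of \<open>T \<times> \<real>\<close>. By maximality
it is \<open>T\<close>. This avoids determining \<open>T\<close> exactly.\<close>

lemma maximal_torus_contains_phases:
  fixes \<theta> :: "'n::finite \<Rightarrow> real"
  assumes T: "diagonal_maximal_torus G T"
    and mult: "\<And>x y. cdiag x \<in> G \<Longrightarrow> cdiag y \<in> G \<Longrightarrow> cdiag x ** cdiag y \<in> G"
    and \<theta>: "\<And>s::real. phase (\<lambda>i. s * \<theta> i) \<in> G"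
  shows "phase (\<lambda>i. s * \<theta> i) \<in> T"
proof -
  interpret GL: group "GL :: (complex^'n^'n) monoid" by (rule group_GL)
  define c :: "real \<Rightarrow> complex^'n^'n" where "c s = phase (\<lambda>i. s * \<theta> i)" for s
  define T' where "T' = (\<lambda>(t,s). t ** c s) ` (T \<times> UNIV)"
  have sub: "subgroup T GL" and TG: "T \<subseteq> G" "T \<subseteq> unitary_group" and conT: "connected T"
    using T by (auto simp: diagonal_maximal_torus_def connected_commutative_subgroup_def)
  have diag: "\<exists>z. t = cdiag z" if "t \<in> T" for t using maximal_torus_diagonal[OF T that] by blast
  have T1: "Finite_Cartesian_Product.mat 1 \<in> T" using subgroup.one_closed[OF sub] by (simp add: GL_def)
  have c0: "c 0 = Finite_Cartesian_Product.mat 1" by (simp add: c_def phase_def cdiag_one)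
  have cadd: "c s ** c s' = c (s + s')" for s s' by (simp add: c_def phase_add algebra_simps)
  have cdg: "\<exists>z. c s = cdiag z" for s by (auto simp: c_def phase_def)
  have cinv: "invertible (c s)" for s unfolding c_def phase_def by (rule cdiag_invertible) simp
  have comm: "x ** y = y ** x" if "\<exists>z. x = cdiag z" "\<exists>z. y = cdiag z" for x y :: "complex^'n^'n"
    using that by (auto simp: cdiag_mult mult.commute)
  have dg': "\<exists>z. x = cdiag z" if "x \<in> T'" for x
  proof -
    obtain t s where x: "x = t ** c s" "t \<in> T" using \<open>x \<in> T'\<close> by (auto simp: T'_def)
    obtain z y where "t = cdiag z" "c s = cdiag y" using diag[OF x(2)] cdg[of s] by blast
    thus ?thesis using x(1) cdiag_mult[of z y] by (intro exI) simp
  qed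
  have "subgroup T' GL"
  proof (rule GL.subgroupI)
    show "T' \<subseteq> carrier GL"
      using subgroup.subset[OF sub] cinv by (auto simp: T'_def GL_def intro!: invertible_mult)
    show "T' \<noteq> {}" using T1 by (auto simp: T'_def)
    fix x y assume "x \<in> T'" "y \<in> T'"
    then obtain t s t' s' where xy: "x = t ** c s" "y = t' ** c s'" "t \<in> T" "t' \<in> T" by (auto simp: T'_def)
    have "x ** y = (t ** t') ** (c s ** c s')"
      unfolding xy using comm[OF cdg[of s] diag[OF xy(4)]] by (metis matrix_mul_assoc)
    moreover have "t ** t' \<in> T" using subgroup.m_closed[OF sub xy(3,4)] by (simp add: GL_def)
    ultimately show "x \<otimes>\<^bsub>GL\<^esub> y \<in> T'" unfolding T'_def cadd by (auto simp: GL_def)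
  next
    fix x assume "x \<in> T'"
    then obtain t s where x: "x = t ** c s" "t \<in> T" by (auto simp: T'_def)
    have tG: "t \<in> carrier GL" using subgroup.subset[OF sub] x by blast
    have cG: "c s \<in> carrier GL" "c (- s) \<in> carrier GL" using cinv by (auto simp: GL_def)
    have "inv\<^bsub>GL\<^esub> (c s) = c (- s)"
      by (rule GL.inv_equality) (use cG cadd[of "- s" s] c0 in \<open>auto simp: GL_def\<close>)
    hence "inv\<^bsub>GL\<^esub> x = c (- s) \<otimes>\<^bsub>GL\<^esub> inv\<^bsub>GL\<^esub> t"
      using GL.inv_mult_group[OF tG cG(1)] x(1) by (simp add: GL_def)
    also have "\<dots> = inv\<^bsub>GL\<^esub> t ** c (- s)"
      using comm[OF cdg diag[OF subgroup.m_inv_closed[OF sub x(2)]]] by (simp add: GL_def)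
    finally show "inv\<^bsub>GL\<^esub> x \<in> T'"
      using subgroup.m_inv_closed[OF sub x(2)] by (auto simp: T'_def)
  qed
  moreover have "T' \<subseteq> G \<inter> unitary_group"
  proof
    fix x assume "x \<in> T'"
    then obtain t s where x: "x = t ** c s" "t \<in> T" by (auto simp: T'_def)
    obtain z where z: "t = cdiag z" using diag[OF x(2)] by blast
    have "x \<in> G" unfolding x(1) z c_def phase_def
      by (rule mult) (use TG x(2) z \<theta> in \<open>auto simp: phase_def\<close>)
    moreover have "x \<in> unitary_group"
    proof -
      have "cdiag z \<in> unitary_group" using TG(2) x(2) z by auto
      moreover have "phase (\<lambda>i. s * \<theta> i) \<in> unitary_group" by (rule phase_unitary)
      ultimately show ?thesis
        unfolding x(1) z c_def phase_def cdiag_mult cdiag_unitary by (simp add: mult_ac)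
    qed
    ultimately show "x \<in> G \<inter> unitary_group" by blast
  qed
  moreover have "connected T'"
    unfolding T'_def
  proof (rule connected_continuous_image)
    have eq: "(\<lambda>(t,s). t ** c s) = (\<lambda>ts. \<chi> i j. fst ts $ i $ j * exp (\<i> * complex_of_real (snd ts * \<theta> j)))"
      by (auto simp: fun_eq_iff Finite_Cartesian_Product.vec_eq_iff c_def phase_def mult_cdiag_nth)
    show "continuous_on (T \<times> UNIV) (\<lambda>(t,s). t ** c s)"
      unfolding eq by (intro continuous_intros)
    show "connected (T \<times> (UNIV :: real set))" using conT by (intro connected_Times) auto
  qed
  moreover have "\<forall>s\<in>T'. \<forall>t\<in>T'. s ** t = t ** s" using comm dg' by blast
  ultimately have "connected_commutative_subgroup (G \<inter> unitary_group) T'"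
    by (simp add: connected_commutative_subgroup_def)
  moreover have "T \<subseteq> T'"
  proof
    fix t assume "t \<in> T"
    moreover have "t = t ** c 0" by (simp add: c0)
    ultimately show "t \<in> T'" unfolding T'_def by force
  qed
  ultimately have "T' = T" using T by (auto simp: diagonal_maximal_torus_def)
  moreover have "c s \<in> T'" unfolding T'_def
    using T1 by (intro image_eqI[of _ _ "(Finite_Cartesian_Product.mat 1, s)"]) auto
  ultimately show ?thesis by (simp add: c_def)
qed

lemma phases_lie_algebra:
  fixes \<theta> :: "'n::finite \<Rightarrow> real"
  assumes ph: "\<And>s::real. phase (\<lambda>i. s * \<theta> i) \<in> T"
  shows "cdiag (\<lambda>i. \<i> * complex_of_real (\<theta> i)) \<in> lie_algebra T"
proof -
  have "mexp (t *\<^sub>R cdiag (\<lambda>i. \<i> * complex_of_real (\<theta> i))) = phase (\<lambda>i. t * \<theta> i)" for t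
    unfolding scaleR_cdiag mexp_cdiag phase_def by (simp add: scaleR_conv_of_real mult_ac)
  thus ?thesis using ph by (simp add: lie_algebra_def)
qed

lemma phases_lie_algebra_complex_torus:
  fixes \<theta> :: "'n::finite \<Rightarrow> real"
  assumes T: "diagonal_maximal_torus G T" and ph: "\<And>s::real. phase (\<lambda>i. s * \<theta> i) \<in> T"
  shows "cdiag (\<lambda>i. complex_of_real (\<theta> i)) \<in> lie_algebra (complex_torus T)"
proof -
  have sub: "subgroup T GL"
    using T by (auto simp: diagonal_maximal_torus_def connected_commutative_subgroup_def)
  have T1: "Finite_Cartesian_Product.mat 1 \<in> T" using subgroup.one_closed[OF sub] by (simp add: GL_def)
  have "mexp (t *\<^sub>R cdiag (\<lambda>i. complex_of_real (\<theta> i))) \<in> complex_torus T" for t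
  proof -
    \<comment> \<open>the factor \<open>\<i>\<close> in the definition of the complex torus turns \<open>X\<close> into a real diagonal matrix\<close>
    define X where "X = cdiag (\<lambda>i. \<i> * complex_of_real (- t * \<theta> i))"
    have "X \<in> lie_algebra T" unfolding X_def
      by (rule phases_lie_algebra) (use ph[of "- (s * t)" for s] in \<open>simp add: mult.assoc\<close>)
    moreover have "map_matrix ((*) \<i>) X = t *\<^sub>R cdiag (\<lambda>i. complex_of_real (\<theta> i))"
      unfolding X_def scaleR_cdiag by (simp add: map_matrix_cdiag cdiag_eq_iff fun_eq_iff scaleR_conv_of_real mult.assoc[symmetric])
    ultimately show ?thesis using T1 unfolding complex_torus_def by force
  qed
  thus ?thesis by (simp add: lie_algebra_def)
qed

lemma lie_algebra_diagonal:
  assumes "\<And>t. t \<in> T \<Longrightarrow> \<forall>i j. i \<noteq> j \<longrightarrow> t $ i $ j = 0" and "X \<in> lie_algebra T"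
  shows "X = cdiag (\<lambda>i. X $ i $ i)"
proof (rule diagonal_imp_cdiag, intro allI impI)
  fix i j :: 'a assume "i \<noteq> j"
  moreover have "mexp (t *\<^sub>R X) \<in> T" for t :: real using assms(2) by (simp add: lie_algebra_def)
  ultimately have "mexp (t *\<^sub>R X) $ i $ j = 0" for t :: real using assms(1) by blast
  thus "X $ i $ j = 0" by (rule mexp_entry_zero_imp_entry_zero)
qed

text \<open>The weight condition is imposed for the whole Lie algebra of the complex torus; hence it suffices to
check it on diagonal matrices.\<close>

lemma lie_algebra_complex_torus_diagonal:
  assumes T: "diagonal_maximal_torus G T" and H: "H \<in> lie_algebra (complex_torus T)"
  shows "H = cdiag (\<lambda>i. H $ i $ i)"
proof (rule lie_algebra_diagonal[OF _ H])
  fix x assume "x \<in> complex_torus T"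
  then obtain t X where x: "x = t ** mexp (map_matrix ((*) \<i>) X)" "t \<in> T" "X \<in> lie_algebra T"
    by (auto simp: complex_torus_def)
  obtain z where z: "t = cdiag z" using maximal_torus_diagonal[OF T x(2)] by blast
  obtain y where y: "X = cdiag y"
    using lie_algebra_diagonal[OF _ x(3)] T by (auto simp: diagonal_maximal_torus_def)
  show "\<forall>i j. i \<noteq> j \<longrightarrow> x $ i $ j = 0"
    unfolding x(1) y z by (simp add: map_matrix_cdiag mexp_cdiag cdiag_mult)
qed

lemma trace_cdiag_real_diag:
  "Determinants.trace (cdiag h ** real_diag \<omega>) = (\<Sum>i\<in>UNIV. h i * complex_of_real (\<omega> $ i))"
  by (simp add: real_diag_cdiag cdiag_mult Determinants.trace_def)

lemma cdiag_GL_prod: "cdiag z \<in> GL_prod blk \<longleftrightarrow> (\<forall>i. z i \<noteq> 0)"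
proof -
  have "invertible (cdiag z) \<longleftrightarrow> (\<forall>i. z i \<noteq> 0)"
    by (simp add: invertible_det_nz det_cdiag)
  thus ?thesis by (auto simp: GL_prod_def GL_def)
qed

lemma cdiag_SL_prod:
  "cdiag z \<in> SL_prod blk \<longleftrightarrow> (\<forall>i. z i \<noteq> 0) \<and> (\<forall>k. (\<Prod>p\<in>blk -` {k}. z p) = 1)"
proof -
  have "Determinants.det (block_component blk k (cdiag z)) = (\<Prod>p\<in>blk -` {k}. z p)" for k
  proof -
    have "block_component blk k (cdiag z) = cdiag (\<lambda>p. if p \<in> blk -` {k} then z p else 1)"
      by (simp add: block_component_def Finite_Cartesian_Product.vec_eq_iff)
    thus ?thesis by (simp add: det_cdiag prod.If_cases vimage_def)
  qed
  thus ?thesis by (auto simp: SL_prod_def cdiag_GL_prod)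
qed

section \<open>Laurent polynomial one-parameter groups\<close>

text \<open>Multiplying by the variable turns an identity on \<open>s \<noteq> 0\<close> into one that also holds
at 0.\<close>

lemma polynomial_coeffs_zero:
  fixes c :: "nat \<Rightarrow> complex"
  assumes "\<And>s. s \<noteq> 0 \<Longrightarrow> (\<Sum>k\<le>N. c k * s ^ k) = 0" and "k \<le> N"
  shows "c k = 0"
proof -
  define c' where "c' = case_nat 0 c"
  have "(\<Sum>k\<le>Suc N. c' k * s ^ k) = 0" for s
  proof -
    have "(\<Sum>k\<le>Suc N. c' k * s ^ k) = s * (\<Sum>k\<le>N. c k * s ^ k)"
      by (simp only: sum.atMost_Suc_shift) (simp add: c'_def sum_distrib_left mult_ac)
    thus ?thesis using assms(1)[of s] by (cases "s = 0") auto
  qed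
  hence "\<forall>k\<le>Suc N. c' k = 0" using polyfun_eq_0[of c' "Suc N"] by blast
  hence "c' (Suc k) = 0" using assms(2) by blast
  thus ?thesis by (simp add: c'_def)
qed

definition coord :: "'n \<Rightarrow> complex \<Rightarrow> complex^'n^'n::finite" where
  "coord j s = cdiag (\<lambda>i. if i = j then s else 1)"

lemma coord_mult: "coord j s ** coord j t = coord j (s * t)"
  unfolding coord_def cdiag_mult by (simp add: cdiag_eq_iff fun_eq_iff)

lemma coord_commute: "coord j s ** coord i t = coord i t ** coord j s"
  by (simp add: coord_def cdiag_mult mult.commute)

lemma coord_GL_prod: "s \<noteq> 0 \<Longrightarrow> coord j s \<in> GL_prod blk"
  by (simp add: coord_def cdiag_GL_prod)

text \<open>Along one diagonal coordinate the matrix entries are constant or the coordinate itself, and the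
inverse determinant is the inverse of the coordinate.\<close>

lemma regular_function_laurent:
  assumes "f \<in> generated_algebra (entry_functions \<union> {\<lambda>g. inverse (Determinants.det g)})"
  shows "\<exists>m p. \<forall>s. s \<noteq> 0 \<longrightarrow> s ^ m * f (coord j s) = poly p s"
  using assms
proof (induction rule: generated_algebra.induct)
  case (gen f)
  show ?case
  proof (cases "f \<in> entry_functions")
    case True
    then obtain a b where f: "f = (\<lambda>g. g $ a $ b)" by (auto simp: entry_functions_def)
    have "\<forall>s. s \<noteq> 0 \<longrightarrow> s ^ 0 * f (coord j s)
        = poly (if a = b then if a = j then [:0, 1:] else [:1:] else 0) s"
      by (simp add: f coord_def)
    thus ?thesis by blast
  next
    case False
    hence f: "f = (\<lambda>g. inverse (Determinants.det g))" using gen by auto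
    have "\<forall>s. s \<noteq> 0 \<longrightarrow> s ^ 1 * f (coord j s) = poly [:1:] s"
      by (simp add: f coord_def det_cdiag)
    thus ?thesis by blast
  qed
next
  case (const c)
  have "\<forall>s. s \<noteq> 0 \<longrightarrow> s ^ 0 * c = poly [:c:] s" by simp
  thus ?case by blast
next
  case (add f g)
  then obtain m p n q where "\<forall>s. s \<noteq> 0 \<longrightarrow> s ^ m * f (coord j s) = poly p s"
    "\<forall>s. s \<noteq> 0 \<longrightarrow> s ^ n * g (coord j s) = poly q s" by blast
  hence "\<forall>s. s \<noteq> 0 \<longrightarrow> s ^ (m + n) * (f (coord j s) + g (coord j s)) = poly (monom 1 n * p + monom 1 m * q) s"
    by (simp add: poly_monom power_add algebra_simps)
  thus ?case by blast
next
  case (mult f g)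
  then obtain m p n q where "\<forall>s. s \<noteq> 0 \<longrightarrow> s ^ m * f (coord j s) = poly p s"
    "\<forall>s. s \<noteq> 0 \<longrightarrow> s ^ n * g (coord j s) = poly q s" by blast
  hence "\<forall>s. s \<noteq> 0 \<longrightarrow> s ^ (m + n) * (f (coord j s) * g (coord j s)) = poly (p * q) s"
    by (simp add: power_add algebra_simps)
  thus ?case by blast
qed

lemma poly_eq_sum_atMost:
  assumes "degree p \<le> N"
  shows "poly p (x::complex) = (\<Sum>k\<le>N. coeff p k * x ^ k)"
  unfolding poly_altdef
  by (rule sum.mono_neutral_left) (use assms coeff_eq_0[of p] in auto)

text \<open>\<open>P s = \<Sum>\<^sub>k s\<^sup>k\<^sup>-\<^sup>m C\<^sub>k\<close> is multiplicative in \<open>s \<noteq> 0\<close>. The power \<open>s\<^sup>m\<close> clears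
denominators, so that only polynomials have to be compared.\<close>

definition laurent_group ::
  "nat \<Rightarrow> nat \<Rightarrow> (nat \<Rightarrow> complex^'d^'d) \<Rightarrow> (complex \<Rightarrow> complex^'d^'d::finite) \<Rightarrow> bool" where
  "laurent_group m N C P \<longleftrightarrow>
     (\<forall>s a b. s \<noteq> 0 \<longrightarrow> s ^ m * P s $ a $ b = (\<Sum>k\<le>N. C k $ a $ b * s ^ k)) \<and>
     (\<forall>s t. s \<noteq> 0 \<longrightarrow> t \<noteq> 0 \<longrightarrow> P (s * t) = P s ** P t) \<and> P 1 = Finite_Cartesian_Product.mat 1"

lemma rational_representation_mult:
  assumes "rational_representation G \<pi>" "x \<in> G" "y \<in> G"
  shows "\<pi> (x ** y) = \<pi> x ** \<pi> y"
  using assms unfolding rational_representation_def hom_def by (auto simp: GL_def)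

lemma rational_representation_one:
  assumes "rational_representation G \<pi>" "Finite_Cartesian_Product.mat 1 \<in> G"
  shows "\<pi> (Finite_Cartesian_Product.mat 1) = Finite_Cartesian_Product.mat 1"
proof -
  let ?e = "\<pi> (Finite_Cartesian_Product.mat 1)"
  have "?e \<in> carrier GL" using assms unfolding rational_representation_def hom_def by auto
  then obtain B where B: "B ** ?e = Finite_Cartesian_Product.mat 1" by (auto simp: GL_def invertible_def)
  have "?e = (B ** ?e) ** ?e" by (simp add: B)
  also have "\<dots> = B ** \<pi> (Finite_Cartesian_Product.mat 1 ** Finite_Cartesian_Product.mat 1)"
    by (simp only: rational_representation_mult[OF assms(1,2,2)] matrix_mul_assoc)
  finally show ?thesis by (simp add: B)
qed

lemma coordinate_laurent_group:
  fixes \<pi> :: "complex^'n^'n \<Rightarrow> complex^'d^'d"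
  assumes \<pi>: "rational_representation (GL_prod blk) \<pi>"
  shows "\<exists>m N C. laurent_group m N C (\<lambda>s. \<pi> (coord j s))"
proof -
  have "\<exists>m p. \<forall>s. s \<noteq> 0 \<longrightarrow> s ^ m * \<pi> (coord j s) $ a $ b = poly p s" for a b
  proof -
    obtain f where "f \<in> generated_algebra (entry_functions \<union> {\<lambda>g. inverse (Determinants.det g)})"
      "\<forall>g\<in>GL_prod blk. \<pi> g $ a $ b = f g"
      using \<pi> unfolding rational_representation_def by blast
    thus ?thesis using regular_function_laurent[of f j] coord_GL_prod by (metis (no_types, lifting))
  qed
  then obtain m p where mp: "\<And>a b s. s \<noteq> 0 \<Longrightarrow> s ^ m a b * \<pi> (coord j s) $ a $ b = poly (p a b) s"
    by metis
  \<comment> \<open>a common denominator \<open>s\<^sup>M\<close> and a common degree bound for all entries\<close>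
  define M where "M = (\<Sum>a\<in>UNIV. \<Sum>b\<in>UNIV. m a b)"
  define q where "q a b = monom 1 (M - m a b) * p a b" for a b
  define N where "N = (\<Sum>a\<in>UNIV. \<Sum>b\<in>UNIV. degree (q a b))"
  have le: "h a b \<le> (\<Sum>a\<in>UNIV. \<Sum>b\<in>UNIV. h a b)" for h :: "'d \<Rightarrow> 'd \<Rightarrow> nat" and a b
    by (rule order_trans[OF member_le_sum[of b UNIV "h a"] member_le_sum[of a UNIV "\<lambda>a. \<Sum>b\<in>UNIV. h a b"]]) auto
  define C :: "nat \<Rightarrow> complex^'d^'d" where "C k = (\<chi> a b. coeff (q a b) k)" for k
  have "s ^ M * \<pi> (coord j s) $ a $ b = (\<Sum>k\<le>N. C k $ a $ b * s ^ k)" if s: "s \<noteq> 0" for s a b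
  proof -
    have "m a b \<le> M" using le[of m a b] by (simp add: M_def)
    hence "s ^ M = s ^ (M - m a b) * s ^ m a b" by (simp flip: power_add)
    hence "s ^ M * \<pi> (coord j s) $ a $ b = s ^ (M - m a b) * poly (p a b) s"
      using mp[OF s, of a b] by (simp add: mult.assoc)
    also have "\<dots> = poly (q a b) s" by (simp add: q_def poly_monom)
    also have "\<dots> = (\<Sum>k\<le>N. C k $ a $ b * s ^ k)"
      using poly_eq_sum_atMost[of "q a b" N s] le[of "\<lambda>a b. degree (q a b)" a b] by (simp add: N_def C_def)
    finally show ?thesis .
  qed
  moreover have "\<pi> (coord j (s * t)) = \<pi> (coord j s) ** \<pi> (coord j t)" if "s \<noteq> 0" "t \<noteq> 0" for s t
    using rational_representation_mult[OF \<pi> coord_GL_prod coord_GL_prod] that coord_mult by metis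
  moreover have one: "coord j 1 = Finite_Cartesian_Product.mat 1" by (simp add: coord_def cdiag_one)
  hence "\<pi> (coord j 1) = Finite_Cartesian_Product.mat 1"
    using rational_representation_one[OF \<pi>] coord_GL_prod[of 1 j blk] by simp
  ultimately have "laurent_group M N C (\<lambda>s. \<pi> (coord j s))" unfolding laurent_group_def by blast
  thus ?thesis by blast
qed

text \<open>Comparing the coefficients of \<open>A P(s) = P(s) A\<close>.\<close>

lemma laurent_group_coeff_commute:
  assumes L: "laurent_group m N C P" and comm: "\<And>s. s \<noteq> 0 \<Longrightarrow> A ** P s = P s ** A" and k: "k \<le> N"
  shows "A ** C k = C k ** A"
proof -
  have "(A ** C k) $ a $ b - (C k ** A) $ a $ b = 0" for a b
  proof (rule polynomial_coeffs_zero[OF _ k, where c = "\<lambda>k. (A ** C k) $ a $ b - (C k ** A) $ a $ b"])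
    fix s :: complex assume s: "s \<noteq> 0"
    have P: "(\<Sum>k\<le>N. C k $ x $ y * s ^ k) = s ^ m * P s $ x $ y" for x y
      using L s by (simp add: laurent_group_def)
    have "(\<Sum>k\<le>N. (A ** C k) $ a $ b * s ^ k) = (\<Sum>l\<in>UNIV. A $ a $ l * (\<Sum>k\<le>N. C k $ l $ b * s ^ k))"
      unfolding matrix_matrix_mult_def by (simp add: sum_distrib_left sum_distrib_right mult_ac) (rule sum.swap)
    also have "\<dots> = s ^ m * (A ** P s) $ a $ b"
      unfolding P by (simp add: matrix_matrix_mult_def sum_distrib_left mult_ac)
    also have "\<dots> = s ^ m * (P s ** A) $ a $ b" by (simp add: comm[OF s])
    also have "\<dots> = (\<Sum>l\<in>UNIV. (\<Sum>k\<le>N. C k $ a $ l * s ^ k) * A $ l $ b)"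
      unfolding P by (simp add: matrix_matrix_mult_def sum_distrib_left mult_ac)
    also have "\<dots> = (\<Sum>k\<le>N. (C k ** A) $ a $ b * s ^ k)"
      unfolding matrix_matrix_mult_def by (simp add: sum_distrib_left sum_distrib_right mult_ac) (rule sum.swap)
    finally show "(\<Sum>k\<le>N. ((A ** C k) $ a $ b - (C k ** A) $ a $ b) * s ^ k) = 0"
      by (simp add: left_diff_distrib sum_subtractf)
  qed
  thus ?thesis by (simp add: Finite_Cartesian_Product.vec_eq_iff)
qed

text \<open>Comparing the coefficients of \<open>t\<close> in \<open>P(s) P(t) = P(s t)\<close> gives
\<open>P(s) C\<^sub>k = s\<^sup>k\<^sup>-\<^sup>m C\<^sub>k\<close>.\<close>

lemma laurent_group_coeff_eigen:
  assumes L: "laurent_group m N C P" and s: "s \<noteq> 0" and k: "k \<le> N"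
  shows "s ^ m * (P s ** C k) $ a $ b = s ^ k * C k $ a $ b"
proof -
  have "s ^ m * (P s ** C k) $ a $ b - s ^ k * C k $ a $ b = 0"
  proof (rule polynomial_coeffs_zero[OF _ k, where c = "\<lambda>k. s ^ m * (P s ** C k) $ a $ b - s ^ k * C k $ a $ b"])
    fix t :: complex assume t: "t \<noteq> 0"
    have P: "(\<Sum>k\<le>N. C k $ x $ y * u ^ k) = u ^ m * P u $ x $ y" if "u \<noteq> 0" for x y u
      using L that by (simp add: laurent_group_def)
    have "(\<Sum>k\<le>N. s ^ m * (P s ** C k) $ a $ b * t ^ k)
        = s ^ m * (\<Sum>l\<in>UNIV. P s $ a $ l * (\<Sum>k\<le>N. C k $ l $ b * t ^ k))"
      unfolding matrix_matrix_mult_def by (simp add: sum_distrib_left sum_distrib_right mult_ac) (rule sum.swap)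
    also have "\<dots> = (s * t) ^ m * (P s ** P t) $ a $ b"
      unfolding P[OF t] by (simp add: matrix_matrix_mult_def sum_distrib_left power_mult_distrib mult_ac)
    also have "\<dots> = (s * t) ^ m * P (s * t) $ a $ b" using L s t by (simp add: laurent_group_def)
    also have "\<dots> = (\<Sum>k\<le>N. C k $ a $ b * (s * t) ^ k)" using s t by (simp add: P)
    finally show "(\<Sum>k\<le>N. (s ^ m * (P s ** C k) $ a $ b - s ^ k * C k $ a $ b) * t ^ k) = 0"
      by (simp add: left_diff_distrib right_diff_distrib sum_subtractf power_mult_distrib mult_ac)
  qed
  thus ?thesis by simp
qed

text \<open>As \<open>\<Sum>\<^sub>k C\<^sub>k = P(1) = 1\<close>, some component \<open>C\<^sub>k w\<close> of \<open>w\<close> is nonzero, and it is an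
eigenvector of the group. It inherits from \<open>w\<close> the eigenvalues of all operators that commute with the
group, because these commute with \<open>C\<^sub>k\<close>. The last fact makes it possible to treat several coordinates
one after the other.\<close>

lemma laurent_group_component:
  fixes w :: "complex^'d"
  assumes L: "laurent_group m N C P" and w: "w \<noteq> 0"
  obtains k where "k \<le> N" "C k *v w \<noteq> 0"
    "\<And>s. s \<noteq> 0 \<Longrightarrow> P s *v (C k *v w) = (s powi (int k - int m)) *s (C k *v w)"
    "\<And>A c. (\<And>s. s \<noteq> 0 \<Longrightarrow> A ** P s = P s ** A) \<Longrightarrow> A *v w = c *s w \<Longrightarrow> A *v (C k *v w) = c *s (C k *v w)"
proof -
  have "(\<Sum>k\<le>N. C k *v w) = w"
  proof -
    have "(\<Sum>k\<le>N. C k $ a $ b) = (Finite_Cartesian_Product.mat 1 :: complex^'d^'d) $ a $ b" for a b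
    proof -
      have "(1::complex) ^ m * P 1 $ a $ b = (\<Sum>k\<le>N. C k $ a $ b * 1 ^ k)"
        using L unfolding laurent_group_def by (metis one_neq_zero)
      thus ?thesis using L by (simp add: laurent_group_def)
    qed
    hence "(\<Sum>k\<le>N. C k) = Finite_Cartesian_Product.mat 1" by (simp add: Finite_Cartesian_Product.vec_eq_iff)
    moreover have "(\<Sum>k\<le>N. C k *v w) = (\<Sum>k\<le>N. C k) *v w"
      by (induction N) (simp_all add: matrix_vector_mult_add_rdistrib)
    ultimately show ?thesis by simp
  qed
  then obtain k where k: "k \<le> N" "C k *v w \<noteq> 0"
    using w by (metis (no_types, lifting) atMost_iff sum.neutral)
  have "P s *v (C k *v w) = (s powi (int k - int m)) *s (C k *v w)" if s: "s \<noteq> 0" for s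
  proof -
    have pw: "s powi (int k - int m) = s ^ k / s ^ m" using s by (simp add: power_int_diff)
    have "(P s ** C k) $ a $ b = (s powi (int k - int m)) * C k $ a $ b" for a b
      using laurent_group_coeff_eigen[OF L s k(1), of a b] s by (simp add: pw field_simps)
    hence "((P s ** C k) *v w) = (s powi (int k - int m)) *s (C k *v w)"
      by (simp add: matrix_vector_mult_def Finite_Cartesian_Product.vec_eq_iff sum_distrib_left mult_ac)
    thus ?thesis by (simp add: matrix_vector_mul_assoc)
  qed
  moreover have "A *v (C k *v w) = c *s (C k *v w)"
    if comm: "\<And>s. s \<noteq> 0 \<Longrightarrow> A ** P s = P s ** A" and Aw: "A *v w = c *s w" for A c
  proof -
    have "A *v (C k *v w) = (C k ** A) *v w"
      using laurent_group_coeff_commute[OF L comm k(1)] by (simp add: matrix_vector_mul_assoc)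
    also have "\<dots> = C k *v (c *s w)" by (simp add: Aw flip: matrix_vector_mul_assoc)
    also have "\<dots> = c *s (C k *v w)" by (simp add: vector_scalar_commute)
    finally show ?thesis .
  qed
  ultimately show ?thesis using that[OF k] by blast
qed

text \<open>\<open>P(s)\<close> acts on a nonzero component \<open>C\<^sub>k w\<close> both by \<open>s\<^sup>k\<^sup>-\<^sup>m\<close> and, since it commutes with the
group, by the eigenvalue of \<open>w\<close>.\<close>

lemma laurent_group_eigenvalue:
  fixes w :: "complex^'d"
  assumes L: "laurent_group m N C P" and w: "w \<noteq> 0" and s: "s \<noteq> 0" and Pw: "P s *v w = c *s w"
  obtains k where "k \<le> N" "c = s powi (int k - int m)"
proof -
  obtain k where k: "k \<le> N" "C k *v w \<noteq> 0"
    "P s *v (C k *v w) = (s powi (int k - int m)) *s (C k *v w)"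
    "\<And>A c. (\<And>s. s \<noteq> 0 \<Longrightarrow> A ** P s = P s ** A) \<Longrightarrow> A *v w = c *s w \<Longrightarrow> A *v (C k *v w) = c *s (C k *v w)"
    using laurent_group_component[OF L w] s by metis
  have "P s ** P t = P t ** P s" if "t \<noteq> 0" for t
    using L s that unfolding laurent_group_def by (metis mult.commute)
  from k(4)[OF this Pw] k(3) have "c *s (C k *v w) = (s powi (int k - int m)) *s (C k *v w)"
    by (rule trans[OF sym])
  hence "c = s powi (int k - int m)" using k(2) by (metis vector_mul_rcancel)
  thus ?thesis using that k(1) by blast
qed

section \<open>Weights of products of general linear groups\<close>

lemma exp_powi: "exp (x::complex) powi a = exp (x * of_int a)"
  by (cases a rule: int_cases2) (simp_all add: power_int_minus exp_of_nat_mult[symmetric] exp_minus mult.commute)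

lemma phase_GL_prod: "phase \<theta> \<in> GL_prod blk"
  by (simp add: phase_def cdiag_GL_prod)

lemma cdiag_GL_prod_mult: "cdiag x \<in> GL_prod blk \<Longrightarrow> cdiag y \<in> GL_prod blk \<Longrightarrow> cdiag x ** cdiag y \<in> GL_prod blk"
  by (simp add: cdiag_mult cdiag_GL_prod)

lemma weight_vector_exists:
  assumes "\<omega> \<in> weights T \<pi>"
  obtains w where "w \<in> weight_space T \<pi> \<omega>" "w \<noteq> 0"
proof -
  have "0 \<in> weight_space T \<pi> \<omega>" by (simp add: weight_space_def)
  thus ?thesis using assms that unfolding weights_def by blast
qed

lemma weight_vector_real_exp:
  fixes \<pi> :: "complex^'n^'n \<Rightarrow> complex^'d^'d"
  assumes T: "diagonal_maximal_torus G T" and ph: "\<And>s::real. phase (\<lambda>i. s * \<theta> i) \<in> T"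
    and w: "w \<in> weight_space T \<pi> \<omega>"
  shows "\<pi> (cdiag (\<lambda>i. exp (complex_of_real (\<theta> i)))) *v w
    = exp (complex_of_real (\<Sum>i\<in>UNIV. \<theta> i * \<omega> $ i)) *s w"
  using w phases_lie_algebra_complex_torus[OF T ph] unfolding weight_space_def
  by (auto simp: mexp_cdiag trace_cdiag_real_diag dest!: bspec)

text \<open>The diagonal matrix with entry \<open>e\<close> at \<open>j\<close> and 1 elsewhere acts on a vector of weight \<open>\<omega>\<close> by
\<open>e\<close> to the power \<open>\<omega>\<^sub>j\<close>, and on the other hand by one of finitely many integral powers of \<open>e\<close>.\<close>

theorem GL_prod_weights_integral_finite:
  fixes \<pi> :: "complex^'n^'n \<Rightarrow> complex^'d^'d"
  assumes T: "diagonal_maximal_torus (GL_prod blk) T" and \<pi>: "rational_representation (GL_prod blk) \<pi>"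
  shows "finite (weights T \<pi>)" "\<And>\<omega> j. \<omega> \<in> weights T \<pi> \<Longrightarrow> \<omega> $ j \<in> \<int>"
proof -
  have "\<exists>m N C. laurent_group m N C (\<lambda>s. \<pi> (coord j s))" for j
    by (rule coordinate_laurent_group[OF \<pi>])
  then obtain m N C where L: "\<And>j. laurent_group (m j) (N j) (C j) (\<lambda>s. \<pi> (coord j s))" by metis
  define F where "F j = (\<lambda>k. of_int (int k - int (m j)) :: real) ` {..N j}" for j
  have ph: "phase \<theta> \<in> T" for \<theta> :: "'n \<Rightarrow> real"
    using maximal_torus_contains_phases[OF T cdiag_GL_prod_mult, of \<theta> 1] phase_GL_prod by auto
  have mem: "\<omega> $ j \<in> F j" if \<omega>: "\<omega> \<in> weights T \<pi>" for \<omega> j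
  proof -
    obtain w where w: "w \<in> weight_space T \<pi> \<omega>" "w \<noteq> 0" using weight_vector_exists[OF \<omega>] .
    define \<theta> :: "'n \<Rightarrow> real" where "\<theta> i = (if i = j then 1 else 0)" for i
    have "cdiag (\<lambda>i. exp (complex_of_real (\<theta> i))) = coord j (exp 1)"
      by (simp add: coord_def cdiag_eq_iff fun_eq_iff \<theta>_def)
    moreover have "(\<Sum>i\<in>UNIV. \<theta> i * \<omega> $ i) = (\<Sum>i\<in>UNIV. if i = j then \<omega> $ j else 0)"
      by (intro sum.cong) (auto simp: \<theta>_def)
    ultimately have "\<pi> (coord j (exp 1)) *v w = exp (complex_of_real (\<omega> $ j)) *s w"
      using weight_vector_real_exp[OF T ph w(1), of \<theta>] by simp
    then obtain k where k: "k \<le> N j" "exp (complex_of_real (\<omega> $ j)) = exp 1 powi (int k - int (m j))"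
      using laurent_group_eigenvalue[OF L[of j] w(2), of "exp 1" "exp (complex_of_real (\<omega> $ j))"] by auto
    have "exp (complex_of_real (\<omega> $ j)) = exp (complex_of_real (of_int (int k - int (m j))))"
      unfolding k(2) exp_powi by simp
    hence "complex_of_real (exp (\<omega> $ j)) = complex_of_real (exp (of_int (int k - int (m j))))"
      by (simp only: exp_of_real)
    hence "\<omega> $ j = of_int (int k - int (m j))" by (simp only: of_real_eq_iff exp_inj_iff)
    thus ?thesis using k(1) unfolding F_def by blast
  qed
  have "weights T \<pi> \<subseteq> vec_lambda ` (PiE UNIV F)"
  proof
    fix \<omega> assume "\<omega> \<in> weights T \<pi>"
    hence "(\<lambda>j. \<omega> $ j) \<in> PiE UNIV F" using mem by auto
    moreover have "\<omega> = vec_lambda (\<lambda>j. \<omega> $ j)" by simp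
    ultimately show "\<omega> \<in> vec_lambda ` (PiE UNIV F)" by blast
  qed
  moreover have "finite (PiE UNIV F)" by (intro finite_PiE) (auto simp: F_def)
  ultimately show "finite (weights T \<pi>)" by (meson finite_imageI finite_subset)
  show "\<omega> $ j \<in> \<int>" if "\<omega> \<in> weights T \<pi>" for \<omega> j
    using mem[OF that, of j] unfolding F_def by (auto simp del: of_int_diff)
qed

text \<open>The bound on row norms has to be at least 1. It is if some weight is nonzero, because weights are
integral; and otherwise no \<open>\<Gamma>\<close> qualifies and the margin is infinite.\<close>

theorem GL_prod_weight_margin:
  fixes \<pi> :: "complex^'n^'n \<Rightarrow> complex^'d^'d"
  assumes T: "diagonal_maximal_torus (GL_prod blk) T" and \<pi>: "rational_representation (GL_prod blk) \<pi>"
  shows "ereal (weight_norm (weights T \<pi>) powi (1 - int CARD('n)) * inverse (real CARD('n)))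
    \<le> weight_margin (weights T \<pi>)"
proof (cases "weights T \<pi> \<subseteq> {0}")
  case True
  thus ?thesis by (simp add: weight_margin_trivial)
next
  case False
  note fin = GL_prod_weights_integral_finite(1)[OF T \<pi>] and int = GL_prod_weights_integral_finite(2)[OF T \<pi>]
  have le: "norm \<omega> \<le> weight_norm (weights T \<pi>)" if "\<omega> \<in> weights T \<pi>" for \<omega>
    unfolding weight_norm_def using fin that by (intro Max_ge) auto
  obtain \<omega> where "\<omega> \<in> weights T \<pi>" "\<omega> \<noteq> 0" using False by blast
  hence "1 \<le> weight_norm (weights T \<pi>)"
    using integral_norm_ge_1[of \<omega>] int le by (meson order_trans)
  from weight_margin_scaled_integral[OF fin, of 1, OF _ _ le this] int show ?thesis by simp
qed

section \<open>Weights of products of special linear groups\<close>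

lemma cdiag_SL_prod_mult: "cdiag x \<in> SL_prod blk \<Longrightarrow> cdiag y \<in> SL_prod blk \<Longrightarrow> cdiag x ** cdiag y \<in> SL_prod blk"
  by (simp add: cdiag_mult cdiag_SL_prod prod.distrib)

lemma exp_SL_prod:
  assumes "\<And>k. (\<Sum>p\<in>blk -` {k}. \<theta> p) = 0"
  shows "cdiag (\<lambda>p. exp (c * complex_of_real (\<theta> p))) \<in> SL_prod blk"
proof -
  have "(\<Prod>p\<in>blk -` {k}. exp (c * complex_of_real (\<theta> p))) = exp (c * complex_of_real (\<Sum>p\<in>blk -` {k}. \<theta> p))" for k
    by (simp add: exp_sum[symmetric] sum_distrib_left)
  thus ?thesis using assms by (simp add: cdiag_SL_prod)
qed

lemma phase_SL_prod:
  assumes "\<And>k. (\<Sum>p\<in>blk -` {k}. \<theta> p) = 0"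
  shows "phase (\<lambda>p. s * \<theta> p) \<in> SL_prod blk"
proof -
  have "(\<Sum>p\<in>blk -` {k}. s * \<theta> p) = 0" for k
    using assms[of k] by (simp add: sum_distrib_left[symmetric])
  from exp_SL_prod[OF this, of \<i>] show ?thesis by (simp add: phase_def)
qed

text \<open>Passing to a component of \<open>w\<close> for one coordinate after the other keeps the eigenvalues of the
coordinates already treated, and those of every operator that commutes with the diagonal torus.\<close>

lemma joint_eigenvector:
  fixes \<pi> :: "complex^'n^'n \<Rightarrow> complex^'d^'d" and w :: "complex^'d"
  assumes \<pi>: "rational_representation (GL_prod blk) \<pi>" and w: "w \<noteq> 0"
  shows "\<exists>v a. v \<noteq> 0 \<and> (\<forall>j\<in>S. \<forall>s. s \<noteq> 0 \<longrightarrow> \<pi> (coord j s) *v v = (s powi (a j :: int)) *s v) \<and>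
    (\<forall>A c. (\<forall>j s. s \<noteq> 0 \<longrightarrow> A ** \<pi> (coord j s) = \<pi> (coord j s) ** A) \<longrightarrow> A *v w = c *s w \<longrightarrow> A *v v = c *s v)"
  using finite[of S]
proof (induction S rule: finite_induct)
  case empty
  show ?case using w by auto
next
  case (insert j S)
  then obtain v a where v: "v \<noteq> 0"
    "\<And>i s. i \<in> S \<Longrightarrow> s \<noteq> 0 \<Longrightarrow> \<pi> (coord i s) *v v = (s powi (a i :: int)) *s v"
    "\<And>A c. (\<And>j s. s \<noteq> 0 \<Longrightarrow> A ** \<pi> (coord j s) = \<pi> (coord j s) ** A) \<Longrightarrow> A *v w = c *s w \<Longrightarrow> A *v v = c *s v"
    by blast
  obtain m N C where L: "laurent_group m N C (\<lambda>s. \<pi> (coord j s))"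
    using coordinate_laurent_group[OF \<pi>] by blast
  obtain k where k: "k \<le> N" "C k *v v \<noteq> 0"
    "\<And>s. s \<noteq> 0 \<Longrightarrow> \<pi> (coord j s) *v (C k *v v) = (s powi (int k - int m)) *s (C k *v v)"
    "\<And>A c. (\<And>s. s \<noteq> 0 \<Longrightarrow> A ** \<pi> (coord j s) = \<pi> (coord j s) ** A) \<Longrightarrow> A *v v = c *s v
       \<Longrightarrow> A *v (C k *v v) = c *s (C k *v v)"
    using laurent_group_component[OF L v(1)] by metis
  have comm: "\<pi> (coord i s) ** \<pi> (coord j t) = \<pi> (coord j t) ** \<pi> (coord i s)" if "s \<noteq> 0" "t \<noteq> 0" for i s t
    using rational_representation_mult[OF \<pi> coord_GL_prod coord_GL_prod] that coord_commute by metis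
  define a' where "a' = a(j := int k - int m)"
  have "\<pi> (coord i s) *v (C k *v v) = (s powi a' i) *s (C k *v v)" if "i \<in> insert j S" "s \<noteq> 0" for i s
  proof (cases "i = j")
    case True
    thus ?thesis using k(3)[OF that(2)] by (simp add: a'_def)
  next
    case False
    hence "i \<in> S" using that by blast
    have "\<pi> (coord i s) *v (C k *v v) = (s powi a i) *s (C k *v v)"
      by (rule k(4)[OF comm[OF that(2)] v(2)[OF \<open>i \<in> S\<close> that(2)]])
    thus ?thesis using False by (simp add: a'_def)
  qed
  moreover have "A *v (C k *v v) = c *s (C k *v v)"
    if "\<And>j s. s \<noteq> 0 \<Longrightarrow> A ** \<pi> (coord j s) = \<pi> (coord j s) ** A" "A *v w = c *s w" for A c
    by (rule k(4)[OF that(1) v(3)[OF that]])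
  ultimately show ?case using k(2) by blast
qed

lemma joint_eigenvector_torus:
  fixes \<pi> :: "complex^'n^'n \<Rightarrow> complex^'d^'d"
  assumes \<pi>: "rational_representation (GL_prod blk) \<pi>"
    and v: "\<And>j s. s \<noteq> 0 \<Longrightarrow> \<pi> (coord j s) *v v = (s powi (a j :: int)) *s v"
    and z: "\<And>i. z i \<noteq> 0"
  shows "\<pi> (cdiag z) *v v = (\<Prod>i\<in>UNIV. z i powi a i) *s v"
proof -
  define y where "y S i = (if i \<in> S then z i else 1)" for S i
  have "\<pi> (cdiag (y S)) *v v = (\<Prod>i\<in>S. z i powi a i) *s v" for S
    using finite[of S]
  proof (induction S rule: finite_induct)
    case empty
    have "cdiag (y {}) = Finite_Cartesian_Product.mat 1" by (simp add: y_def cdiag_one[symmetric] cdiag_eq_iff fun_eq_iff)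
    moreover have "cdiag (y {}) \<in> GL_prod blk" by (simp add: y_def cdiag_GL_prod)
    ultimately show ?case using rational_representation_one[OF \<pi>] by simp
  next
    case (insert j S)
    have G: "cdiag (y S) \<in> GL_prod blk" using z by (simp add: y_def cdiag_GL_prod)
    have "cdiag (y (insert j S)) = coord j (z j) ** cdiag (y S)"
      unfolding coord_def cdiag_mult using insert.hyps by (auto simp: y_def cdiag_eq_iff fun_eq_iff)
    hence "\<pi> (cdiag (y (insert j S))) = \<pi> (coord j (z j)) ** \<pi> (cdiag (y S))"
      using rational_representation_mult[OF \<pi> coord_GL_prod[OF z] G] by simp
    hence "\<pi> (cdiag (y (insert j S))) *v v = \<pi> (coord j (z j)) *v ((\<Prod>i\<in>S. z i powi a i) *s v)"
      using insert.IH by (simp add: matrix_vector_mul_assoc[symmetric])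
    also have "\<dots> = (\<Prod>i\<in>S. z i powi a i) *s (z j powi a j *s v)"
      by (simp add: vector_scalar_commute v[OF z])
    finally show ?case using insert.hyps by (simp add: vector_smult_assoc mult.commute)
  qed
  moreover have "y UNIV = z" by (simp add: y_def fun_eq_iff)
  ultimately show ?thesis by metis
qed

text \<open>A weight vector \<open>w\<close> for the torus of the special linear groups has a component \<open>v\<close> that is a joint
eigenvector of all invertible diagonal matrices, with integral exponents \<open>\<alpha>\<close>. If \<open>p\<close>
and \<open>q\<close> are in the same block, the diagonal matrix with entries \<open>e\<close> at \<open>p\<close>, \<open>1/e\<close> at \<open>q\<close> and
1 elsewhere belongs to the complexification of that torus. It has the same eigenvalue on \<open>v\<close> as on \<open>w\<close>, which compares the differences of
\<open>\<alpha>\<close> and \<open>\<omega>\<close>.\<close>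

theorem SL_prod_weight_lifts:
  fixes \<pi> :: "complex^'n^'n \<Rightarrow> complex^'d^'d" and blk :: "'n \<Rightarrow> 'k"
  assumes T: "diagonal_maximal_torus (GL_prod blk) T" and \<pi>: "rational_representation (GL_prod blk) \<pi>"
    and T0: "diagonal_maximal_torus (SL_prod blk) T\<^sub>0"
    and \<omega>: "\<omega> \<in> weights T\<^sub>0 (restrict \<pi> (SL_prod blk))"
  obtains \<alpha> where "\<alpha> \<in> weights T \<pi>" "\<And>p q. blk p = blk q \<Longrightarrow> \<alpha> $ p - \<alpha> $ q = \<omega> $ p - \<omega> $ q"
proof -
  define \<pi>\<^sub>0 where "\<pi>\<^sub>0 = restrict \<pi> (SL_prod blk)"
  obtain w where w: "w \<in> weight_space T\<^sub>0 \<pi>\<^sub>0 \<omega>" "w \<noteq> 0"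
    using weight_vector_exists[OF \<omega>] unfolding \<pi>\<^sub>0_def .
  obtain v a where v: "v \<noteq> 0" "\<And>j s. s \<noteq> 0 \<Longrightarrow> \<pi> (coord j s) *v v = (s powi (a j :: int)) *s v"
    "\<And>A c. (\<And>j s. s \<noteq> 0 \<Longrightarrow> A ** \<pi> (coord j s) = \<pi> (coord j s) ** A) \<Longrightarrow> A *v w = c *s w \<Longrightarrow> A *v v = c *s v"
    using joint_eigenvector[OF \<pi> w(2), of UNIV] by blast
  define \<alpha> :: "real^'n" where "\<alpha> = (\<chi> i. of_int (a i))"
  have exp_act: "\<pi> (cdiag (\<lambda>i. exp (h i))) *v v = exp (\<Sum>i\<in>UNIV. h i * complex_of_real (\<alpha> $ i)) *s v" for h
    using joint_eigenvector_torus[OF \<pi> v(2), of "\<lambda>i. exp (h i)"]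
    by (simp add: exp_powi \<alpha>_def exp_sum)
  have ph: "phase \<theta> \<in> T" for \<theta> :: "'n \<Rightarrow> real"
    using maximal_torus_contains_phases[OF T cdiag_GL_prod_mult, of \<theta> 1] phase_GL_prod by auto
  have "v \<in> weight_space T \<pi> \<alpha>"
    unfolding weight_space_def
  proof (clarify)
    fix H assume "H \<in> lie_algebra (complex_torus T)"
    from lie_algebra_complex_torus_diagonal[OF T this] obtain h where H: "H = cdiag h" by blast
    show "\<pi> (mexp H) *v v = exp (Determinants.trace (H ** real_diag \<alpha>)) *s v"
      unfolding H mexp_cdiag trace_cdiag_real_diag by (rule exp_act)
  qed
  moreover have "real_diag \<alpha> \<in> map_matrix ((*) \<i>) ` lie_algebra T"
  proof -
    have "cdiag (\<lambda>i. \<i> * complex_of_real (- \<alpha> $ i)) \<in> lie_algebra T"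
      by (rule phases_lie_algebra) (rule ph)
    moreover have "real_diag \<alpha> = map_matrix ((*) \<i>) (cdiag (\<lambda>i. \<i> * complex_of_real (- \<alpha> $ i)))"
      by (simp add: real_diag_cdiag map_matrix_cdiag mult.assoc[symmetric])
    ultimately show ?thesis by blast
  qed
  ultimately have "\<alpha> \<in> weights T \<pi>" using v(1) unfolding weights_def by blast
  moreover have "\<alpha> $ p - \<alpha> $ q = \<omega> $ p - \<omega> $ q" if pq: "blk p = blk q" for p q
  proof -
    define \<theta> :: "'n \<Rightarrow> real" where "\<theta> i = (if i = p then 1 else 0) - (if i = q then 1 else 0)" for i
    have sum_\<theta>: "(\<Sum>i\<in>X. \<theta> i * f i) = (if p \<in> X then f p else 0) - (if q \<in> X then f q else 0)" for X f
    proof -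
      have "(\<Sum>i\<in>X. \<theta> i * f i) = (\<Sum>i\<in>X. (if i = p then f i else 0) - (if i = q then f i else 0))"
        by (intro sum.cong) (auto simp: \<theta>_def)
      thus ?thesis by (simp add: sum_subtractf)
    qed
    have bs: "(\<Sum>i\<in>blk -` {k}. \<theta> i) = 0" for k using sum_\<theta>[of "\<lambda>_. 1" "blk -` {k}"] pq by simp
    have ph0: "phase (\<lambda>i. s * \<theta> i) \<in> T\<^sub>0" for s
      by (rule maximal_torus_contains_phases[OF T0 cdiag_SL_prod_mult phase_SL_prod[OF bs]])
    define g where "g = cdiag (\<lambda>i. exp (complex_of_real (\<theta> i)))"
    have gSL: "g \<in> SL_prod blk" using exp_SL_prod[OF bs, of 1] by (simp add: g_def)
    have gGL: "g \<in> GL_prod blk" by (simp add: g_def cdiag_GL_prod)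
    have "\<pi> g *v w = exp (complex_of_real (\<omega> $ p - \<omega> $ q)) *s w"
      using weight_vector_real_exp[OF T0 ph0 w(1)] gSL sum_\<theta>[of "\<lambda>i. \<omega> $ i" UNIV]
      by (simp add: \<pi>\<^sub>0_def g_def)
    moreover have "\<pi> g ** \<pi> (coord j s) = \<pi> (coord j s) ** \<pi> g" if "s \<noteq> 0" for j s
    proof -
      have "g ** coord j s = coord j s ** g" unfolding g_def coord_def cdiag_mult by (simp add: mult.commute)
      thus ?thesis using rational_representation_mult[OF \<pi>] gGL coord_GL_prod[OF that] by metis
    qed
    ultimately have "\<pi> g *v v = exp (complex_of_real (\<omega> $ p - \<omega> $ q)) *s v" using v(3) by blast
    moreover have "\<pi> g *v v = exp (complex_of_real (\<alpha> $ p - \<alpha> $ q)) *s v"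
    proof -
      have "(\<Sum>i\<in>UNIV. complex_of_real (\<theta> i) * complex_of_real (\<alpha> $ i)) = complex_of_real (\<Sum>i\<in>UNIV. \<theta> i * \<alpha> $ i)"
        by simp
      also have "\<dots> = complex_of_real (\<alpha> $ p - \<alpha> $ q)" using sum_\<theta>[of "\<lambda>i. \<alpha> $ i" UNIV] by simp
      finally show ?thesis using exp_act[of "\<lambda>i. complex_of_real (\<theta> i)"] by (simp only: g_def)
    qed
    ultimately have "exp (complex_of_real (\<omega> $ p - \<omega> $ q)) = exp (complex_of_real (\<alpha> $ p - \<alpha> $ q))"
      using v(1) by (metis vector_mul_rcancel)
    hence "complex_of_real (exp (\<omega> $ p - \<omega> $ q)) = complex_of_real (exp (\<alpha> $ p - \<alpha> $ q))"
      by (simp only: exp_of_real)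
    thus ?thesis by (simp only: of_real_eq_iff exp_inj_iff)
  qed
  ultimately show ?thesis using that by blast
qed

text \<open>By definition a weight belongs to \<open>i\<close> times the Lie algebra of the torus, so the matrices with diagonal
entries \<open>exp (- i t \<omega>\<^sub>p)\<close> have determinant 1 on each block for all \<open>t\<close>.\<close>

lemma SL_prod_weight_block_sum:
  fixes blk :: "'n::finite \<Rightarrow> 'k"
  assumes T0: "diagonal_maximal_torus (SL_prod blk) T\<^sub>0" and \<omega>: "\<omega> \<in> weights T\<^sub>0 \<pi>"
  shows "(\<Sum>p\<in>blk -` {k}. \<omega> $ p) = 0"
proof -
  define \<sigma> where "\<sigma> = (\<Sum>p\<in>blk -` {k}. \<omega> $ p)"
  obtain X where X: "X \<in> lie_algebra T\<^sub>0" "real_diag \<omega> = map_matrix ((*) \<i>) X"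
    using \<omega> by (auto simp: weights_def)
  have TS: "T\<^sub>0 \<subseteq> SL_prod blk"
    using T0 by (auto simp: diagonal_maximal_torus_def connected_commutative_subgroup_def)
  have "X $ i $ j = - \<i> * real_diag \<omega> $ i $ j" for i j
    unfolding X(2) by (simp add: mult.assoc[symmetric])
  hence Xd: "X = cdiag (\<lambda>i. - \<i> * complex_of_real (\<omega> $ i))"
    by (simp add: Finite_Cartesian_Product.vec_eq_iff real_diag_cdiag)
  have one: "exp (- \<i> * complex_of_real (t * \<sigma>)) = 1" for t
  proof -
    have "mexp (t *\<^sub>R X) \<in> T\<^sub>0" using X(1) by (simp add: lie_algebra_def)
    hence "cdiag (\<lambda>i. exp (t *\<^sub>R (- \<i> * complex_of_real (\<omega> $ i)))) \<in> SL_prod blk"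
      using TS unfolding Xd scaleR_cdiag mexp_cdiag by (rule rev_subsetD)
    hence "(\<Prod>p\<in>blk -` {k}. exp (t *\<^sub>R (- \<i> * complex_of_real (\<omega> $ p)))) = 1"
      unfolding cdiag_SL_prod by blast
    hence "exp (\<Sum>p\<in>blk -` {k}. t *\<^sub>R (- \<i> * complex_of_real (\<omega> $ p))) = 1" by (simp only: exp_sum finite)
    also have "(\<Sum>p\<in>blk -` {k}. t *\<^sub>R (- \<i> * complex_of_real (\<omega> $ p))) = - \<i> * complex_of_real (t * \<sigma>)"
      by (simp add: \<sigma>_def scaleR_conv_of_real sum_distrib_left mult_ac sum_negf)
    finally show ?thesis .
  qed
  have "\<sigma> = 0"
  proof (rule ccontr)
    assume "\<sigma> \<noteq> 0"
    \<comment> \<open>at \<open>t = \<pi> / \<sigma>\<close> the determinant on the block is \<open>-1\<close>\<close>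
    hence "exp (- \<i> * complex_of_real pi) = 1" using one[of "pi / \<sigma>"] by simp
    thus False by (simp add: exp_minus)
  qed
  thus ?thesis by (simp add: \<sigma>_def)
qed

text \<open>\<open>\<alpha> - \<omega>\<close> is constant on blocks and \<open>\<omega>\<close> has sum 0 on blocks. So \<open>\<omega>\<close> is the
orthogonal projection of \<open>\<alpha>\<close>: its entries are those of \<open>\<alpha>\<close> minus the block averages.\<close>

lemma block_average_projection:
  fixes \<alpha> \<omega> :: "real^'n" and blk :: "'n \<Rightarrow> 'k::finite"
  assumes z: "\<And>k. (\<Sum>p\<in>blk -` {k}. \<omega> $ p) = 0"
    and d: "\<And>p q. blk p = blk q \<Longrightarrow> \<alpha> $ p - \<alpha> $ q = \<omega> $ p - \<omega> $ q"
  shows "real (card (blk -` {blk p})) * \<omega> $ p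
      = real (card (blk -` {blk p})) * \<alpha> $ p - (\<Sum>q\<in>blk -` {blk p}. \<alpha> $ q)"
    and "norm \<omega> \<le> norm \<alpha>"
proof -
  have "(\<Sum>q\<in>blk -` {blk p}. \<alpha> $ p - \<alpha> $ q) = (\<Sum>q\<in>blk -` {blk p}. \<omega> $ p - \<omega> $ q)"
    by (intro sum.cong refl d) simp
  thus "real (card (blk -` {blk p})) * \<omega> $ p
      = real (card (blk -` {blk p})) * \<alpha> $ p - (\<Sum>q\<in>blk -` {blk p}. \<alpha> $ q)"
    using z[of "blk p"] by (simp add: sum_subtractf)
next
  have "\<omega> \<bullet> (\<alpha> - \<omega>) = (\<Sum>p\<in>UNIV. \<omega> $ p * (\<alpha> $ p - \<omega> $ p))" by (simp add: inner_vec_def)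
  also have "\<dots> = (\<Sum>k\<in>UNIV. \<Sum>p\<in>{p\<in>UNIV. blk p = k}. \<omega> $ p * (\<alpha> $ p - \<omega> $ p))"
    by (rule sum.group[symmetric]) auto
  also have "\<dots> = (\<Sum>k\<in>(UNIV::'k set). 0)"
  proof (intro sum.cong refl)
    fix k
    show "(\<Sum>p\<in>{p\<in>UNIV. blk p = k}. \<omega> $ p * (\<alpha> $ p - \<omega> $ p)) = 0"
    proof (cases "\<exists>q. blk q = k")
      case True
      then obtain q where q: "blk q = k" by blast
      have "(\<Sum>p\<in>{p\<in>UNIV. blk p = k}. \<omega> $ p * (\<alpha> $ p - \<omega> $ p))
          = (\<Sum>p\<in>blk -` {k}. \<omega> $ p * (\<alpha> $ q - \<omega> $ q))"
      proof (intro sum.cong)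
        fix p assume "p \<in> blk -` {k}"
        hence "\<alpha> $ p - \<alpha> $ q = \<omega> $ p - \<omega> $ q" using d q by simp
        hence "\<alpha> $ p - \<omega> $ p = \<alpha> $ q - \<omega> $ q" by linarith
        thus "\<omega> $ p * (\<alpha> $ p - \<omega> $ p) = \<omega> $ p * (\<alpha> $ q - \<omega> $ q)" by simp
      qed auto
      thus ?thesis using z[of k] by (simp add: sum_distrib_right[symmetric])
    next
      case False
      hence "{p\<in>UNIV. blk p = k} = {}" by auto
      thus ?thesis by (simp only: sum.empty)
    qed
  qed
  finally have orth: "\<omega> \<bullet> (\<alpha> - \<omega>) = 0" by simp
  have "norm \<omega> * norm \<omega> = \<omega> \<bullet> \<alpha>" using orth by (simp add: inner_diff_right power2_norm_eq_inner[symmetric] power2_eq_square)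
  also have "\<dots> \<le> norm \<omega> * norm \<alpha>" by (rule norm_cauchy_schwarz)
  finally show "norm \<omega> \<le> norm \<alpha>" by (cases "norm \<omega> = 0") auto
qed

text \<open>Every weight of the restriction is the projection of an integral weight \<open>\<alpha>\<close>. This makes \<open>R \<omega>\<close>
integral, because \<open>R\<close> is a multiple of all block sizes; it also makes the set of these weights finite and
bounds their norms by that of \<open>\<alpha>\<close>.\<close>

theorem SL_prod_weight_margin:
  fixes \<pi> :: "complex^'n^'n \<Rightarrow> complex^'d^'d" and blk :: "'n \<Rightarrow> 'k::finite"
  assumes blk: "surj blk" and T: "diagonal_maximal_torus (GL_prod blk) T"
    and \<pi>: "rational_representation (GL_prod blk) \<pi>"
    and T0: "diagonal_maximal_torus (SL_prod blk) T\<^sub>0"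
    and R: "R = Lcm (range (\<lambda>i. card (blk -` {i})))"
  shows "ereal (real R powi (- int CARD('n)) * weight_norm (weights T \<pi>) powi (1 - int CARD('n))
      * inverse (real CARD('n))) \<le> weight_margin (weights T\<^sub>0 (restrict \<pi> (SL_prod blk)))"
proof (cases "weights T\<^sub>0 (restrict \<pi> (SL_prod blk)) \<subseteq> {0}")
  case True
  thus ?thesis by (simp add: weight_margin_trivial)
next
  case False
  define \<Omega> \<Omega>\<^sub>0 where "\<Omega> = weights T \<pi>" and "\<Omega>\<^sub>0 = weights T\<^sub>0 (restrict \<pi> (SL_prod blk))"
  note fin = GL_prod_weights_integral_finite(1)[OF T \<pi>, folded \<Omega>_def]
    and int = GL_prod_weights_integral_finite(2)[OF T \<pi>, folded \<Omega>_def]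
  have blocks: "0 < card (blk -` {k})" for k
  proof -
    obtain p where "k = blk p" using blk by (rule surjE)
    thus ?thesis by (auto simp: card_gt_0_iff)
  qed
  have R0: "R > 0"
  proof -
    have "0 \<notin> range (\<lambda>i. card (blk -` {i}))"
    proof
      assume "0 \<in> range (\<lambda>i. card (blk -` {i}))"
      then obtain i where "0 = card (blk -` {i})" by (rule rangeE)
      thus False using blocks[of i] by linarith
    qed
    moreover have "finite (range (\<lambda>i. card (blk -` {i})))" by simp
    ultimately have "R \<noteq> 0" unfolding R using Lcm_0_iff by blast
    thus ?thesis by simp
  qed
  have lift: "\<exists>\<alpha>\<in>\<Omega>. (\<forall>p. real (card (blk -` {blk p})) * \<omega> $ p
      = real (card (blk -` {blk p})) * \<alpha> $ p - (\<Sum>q\<in>blk -` {blk p}. \<alpha> $ q)) \<and> norm \<omega> \<le> norm \<alpha>"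
    if \<omega>: "\<omega> \<in> \<Omega>\<^sub>0" for \<omega>
  proof -
    obtain \<alpha> where \<alpha>: "\<alpha> \<in> \<Omega>" "\<And>p q. blk p = blk q \<Longrightarrow> \<alpha> $ p - \<alpha> $ q = \<omega> $ p - \<omega> $ q"
      using SL_prod_weight_lifts[OF T \<pi> T0 \<omega>[unfolded \<Omega>\<^sub>0_def]] unfolding \<Omega>_def by blast
    show ?thesis
      using block_average_projection[OF SL_prod_weight_block_sum[OF T0 \<omega>[unfolded \<Omega>\<^sub>0_def]] \<alpha>(2)] \<alpha>(1) by blast
  qed
  define proj :: "real^'n \<Rightarrow> real^'n" where
    "proj \<alpha> = (\<chi> p. \<alpha> $ p - (\<Sum>q\<in>blk -` {blk p}. \<alpha> $ q) / real (card (blk -` {blk p})))" for \<alpha>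
  have "\<Omega>\<^sub>0 \<subseteq> proj ` \<Omega>"
  proof
    fix \<omega> assume "\<omega> \<in> \<Omega>\<^sub>0"
    then obtain \<alpha> where \<alpha>: "\<alpha> \<in> \<Omega>" "\<And>p. real (card (blk -` {blk p})) * \<omega> $ p
      = real (card (blk -` {blk p})) * \<alpha> $ p - (\<Sum>q\<in>blk -` {blk p}. \<alpha> $ q)" using lift by blast
    have "\<omega> $ p = proj \<alpha> $ p" for p
    proof -
      define c where "c = real (card (blk -` {blk p}))"
      have "c \<noteq> 0" using blocks[of "blk p"] unfolding c_def by linarith
      hence "\<omega> $ p = (c * \<omega> $ p) / c" by simp
      also have "\<dots> = (c * \<alpha> $ p - (\<Sum>q\<in>blk -` {blk p}. \<alpha> $ q)) / c"
        unfolding c_def \<alpha>(2) ..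
      also have "\<dots> = proj \<alpha> $ p"
        using \<open>c \<noteq> 0\<close> by (simp add: proj_def diff_divide_distrib flip: c_def)
      finally show ?thesis .
    qed
    thus "\<omega> \<in> proj ` \<Omega>" using \<alpha>(1) by (auto simp: Finite_Cartesian_Product.vec_eq_iff)
  qed
  hence fin0: "finite \<Omega>\<^sub>0" using fin by (meson finite_imageI finite_subset)
  have le: "norm \<alpha> \<le> weight_norm \<Omega>" if "\<alpha> \<in> \<Omega>" for \<alpha>
    unfolding weight_norm_def using fin that by (intro Max_ge) auto
  have le0: "norm \<omega> \<le> weight_norm \<Omega>" if "\<omega> \<in> \<Omega>\<^sub>0" for \<omega> using lift[OF that] le by (meson order_trans)
  have int0: "real R * \<omega> $ p \<in> \<int>" if "\<omega> \<in> \<Omega>\<^sub>0" for \<omega> p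
  proof -
    obtain \<alpha> where \<alpha>: "\<alpha> \<in> \<Omega>" "real (card (blk -` {blk p})) * \<omega> $ p
      = real (card (blk -` {blk p})) * \<alpha> $ p - (\<Sum>q\<in>blk -` {blk p}. \<alpha> $ q)" using lift[OF \<open>\<omega> \<in> \<Omega>\<^sub>0\<close>] by blast
    have "card (blk -` {blk p}) dvd R" unfolding R by (rule dvd_Lcm) simp
    then obtain c where c: "R = card (blk -` {blk p}) * c" by (auto elim: dvdE)
    have "real R * \<omega> $ p = real c * (real (card (blk -` {blk p})) * \<omega> $ p)" by (simp add: c)
    also have "\<dots> \<in> \<int>" unfolding \<alpha>(2) by (intro Ints_mult Ints_diff Ints_sum int[OF \<alpha>(1)]) auto
    finally show ?thesis .
  qed
  obtain \<omega> where \<omega>: "\<omega> \<in> \<Omega>\<^sub>0" "\<omega> \<noteq> 0" using False unfolding \<Omega>\<^sub>0_def by blast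
  then obtain \<alpha> where \<alpha>: "\<alpha> \<in> \<Omega>" "norm \<omega> \<le> norm \<alpha>" using lift by blast
  hence "\<alpha> \<noteq> 0" using \<omega>(2) by auto
  hence "1 \<le> weight_norm \<Omega>"
    using order_trans[OF integral_norm_ge_1[OF int[OF \<alpha>(1)]] le[OF \<alpha>(1)]] by blast
  from weight_margin_scaled_integral[OF fin0 R0 int0 le0 this] show ?thesis unfolding \<Omega>_def \<Omega>\<^sub>0_def .
qed

section \<open>The bounds for gap and weight margin\<close>

theorem theorem6p10:
  shows
  "(\<forall>m n (M :: real Matrix.mat) b.
      M \<in> carrier_mat m n \<longrightarrow> M \<noteq> 0\<^sub>m m n \<longrightarrow>
      1 \<le> b \<longrightarrow> (\<forall>i<m. l2norm (Matrix.row M i) \<le> b) \<longrightarrow>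
      gap M \<ge> min_subdet M * b powi (1 - int n) * real n powr (- 1 / 2))
   \<and>
   (\<forall>(G :: (complex^'n^'n) set) T (\<pi> :: complex^'n^'n \<Rightarrow> complex^'d^'d) m M b.
      symmetric_subgroup G \<longrightarrow> diagonal_maximal_torus G T \<longrightarrow> rational_representation G \<pi> \<longrightarrow>
      is_weight_matrix (weights T \<pi>) M \<longrightarrow>
      M \<in> carrier_mat m CARD('n) \<longrightarrow> M \<noteq> 0\<^sub>m m CARD('n) \<longrightarrow>
      1 \<le> b \<longrightarrow> (\<forall>i<m. l2norm (Matrix.row M i) \<le> b) \<longrightarrow>
      weight_margin (weights T \<pi>)
        \<ge> ereal (min_subdet M * b powi (1 - int CARD('n)) * inverse (real CARD('n))))
   \<and>
   (\<forall>(blk :: 'n \<Rightarrow> 'k::finite) T (\<pi> :: complex^'n^'n \<Rightarrow> complex^'d^'d).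
      surj blk \<longrightarrow>
      diagonal_maximal_torus (GL_prod blk) T \<longrightarrow> rational_representation (GL_prod blk) \<pi> \<longrightarrow>
      weight_margin (weights T \<pi>)
        \<ge> ereal (weight_norm (weights T \<pi>) powi (1 - int CARD('n)) * inverse (real CARD('n))))
   \<and>
   (\<forall>(blk :: 'n \<Rightarrow> 'k::finite) T T\<^sub>0 (\<pi> :: complex^'n^'n \<Rightarrow> complex^'d^'d) \<pi>\<^sub>0 R.
      surj blk \<longrightarrow>
      diagonal_maximal_torus (GL_prod blk) T \<longrightarrow> rational_representation (GL_prod blk) \<pi> \<longrightarrow>
      diagonal_maximal_torus (SL_prod blk) T\<^sub>0 \<longrightarrow> \<pi>\<^sub>0 = restrict \<pi> (SL_prod blk) \<longrightarrow>
      R = Lcm (range (\<lambda>i. card (blk -` {i}))) \<longrightarrow>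
      weight_margin (weights T\<^sub>0 \<pi>\<^sub>0)
        \<ge> ereal (real R powi (- int CARD('n)) * weight_norm (weights T \<pi>) powi (1 - int CARD('n))
                   * inverse (real CARD('n))))"
proof (intro conjI allI impI)
  fix m n and M :: "real Matrix.mat" and b
  assume "M \<in> carrier_mat m n" "M \<noteq> 0\<^sub>m m n" "1 \<le> b" "\<forall>i<m. l2norm (Matrix.row M i) \<le> b"
  thus "gap M \<ge> min_subdet M * b powi (1 - int n) * real n powr (- 1 / 2)"
    by (rule gap_lower_bound)
next
  fix G :: "(complex^'n^'n) set" and T and \<pi> :: "complex^'n^'n \<Rightarrow> complex^'d^'d" and m M b
  assume wm: "is_weight_matrix (weights T \<pi>) M" and M: "M \<in> carrier_mat m CARD('n)"
    and "1 \<le> b" "\<forall>i<m. l2norm (Matrix.row M i) \<le> b"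
  thus "weight_margin (weights T \<pi>)
      \<ge> ereal (min_subdet M * b powi (1 - int CARD('n)) * inverse (real CARD('n)))"
    by (intro weight_margin_lower_bound[OF wm] min_subdet_le) auto
next
  fix blk :: "'n \<Rightarrow> 'k" and T and \<pi> :: "complex^'n^'n \<Rightarrow> complex^'d^'d"
  assume "diagonal_maximal_torus (GL_prod blk) T" "rational_representation (GL_prod blk) \<pi>"
  thus "weight_margin (weights T \<pi>)
      \<ge> ereal (weight_norm (weights T \<pi>) powi (1 - int CARD('n)) * inverse (real CARD('n)))"
    by (rule GL_prod_weight_margin)
next
  fix blk :: "'n \<Rightarrow> 'k" and T T\<^sub>0 and \<pi> \<pi>\<^sub>0 :: "complex^'n^'n \<Rightarrow> complex^'d^'d" and R
  assume "surj blk" "diagonal_maximal_torus (GL_prod blk) T" "rational_representation (GL_prod blk) \<pi>"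
    "diagonal_maximal_torus (SL_prod blk) T\<^sub>0" "\<pi>\<^sub>0 = restrict \<pi> (SL_prod blk)"
    "R = Lcm (range (\<lambda>i. card (blk -` {i})))"
  thus "weight_margin (weights T\<^sub>0 \<pi>\<^sub>0)
      \<ge> ereal (real R powi (- int CARD('n)) * weight_norm (weights T \<pi>) powi (1 - int CARD('n))
                   * inverse (real CARD('n)))"
    using SL_prod_weight_margin[of blk T \<pi> T\<^sub>0 R] by simp
qed

end
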